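(* Let $\mathcal{P},\mathcal{S},\mathcal{P}'$ be TRSs such that $\mathcal{S}$ is linear, $\mathcal{P}$ is reversible, $\mathcal{P}' \subseteq \mathcal{P} \cup \mathcal{P}^{-1}$, and $\mathcal{S}$ is terminating relative to $\mathcal{P}'$. Suppose (i) $\mathrm{CP}(\mathcal{S},\mathcal{S}) \subseteq {\stackrel{*}{\to}}_{\mathcal{S}\cup\mathcal{P}'} \circ {\stackrel{=}{\gets}}_{\mathcal{P}\cup\mathcal{P}^{-1}} \circ {\stackrel{*}{\gets}}_{\mathcal{S}\cup\mathcal{P}'}$, (ii) $\mathrm{CP}(\mathcal{P}\cup\mathcal{P}^{-1},\mathcal{S}) \subseteq ({\stackrel{=}{\gets}}_{\mathcal{P}\cup\mathcal{P}^{-1}} \circ {\stackrel{*}{\gets}}_{\mathcal{S}\cup\mathcal{P}'}) \cup ({\to}_{\mathcal{S}} \circ {\stackrel{*}{\to}}_{\mathcal{S}\cup\mathcal{P}'} \circ {\stackrel{=}{\gets}}_{\mathcal{P}\cup\mathcal{P}^{-1}} \circ {\stackrel{*}{\gets}}_{\mathcal{S}\cup\mathcal{P}'})$, and (iii) $\mathrm{CP}(\mathcal{S},\mathcal{P}\cup\mathcal{P}^{-1}) \subseteq ({\stackrel{*}{\to}}_{\mathcal{S}\cup\mathcal{P}'} \circ {\stackrel{=}{\to}}_{\mathcal{P}\cup\mathcal{P}^{-1}}) \cup ({\stackrel{*}{\to}}_{\mathcal{S}\cup\mathcal{P}'} \circ {\stackrel{=}{\to}}_{\mathcal{P}\cup\mathcal{P}^{-1}}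 \circ {\stackrel{*}{\gets}}_{\mathcal{S}\cup\mathcal{P}'} \circ {\gets}_{\mathcal{S}})$. Then $\mathcal{S}\cup\mathcal{P}$ is confluent.
   Context: Terms are built from a signature of fixed-arity function symbols and a set of variables; $\mathcal{V}(t)$ is the set of variables of $t$, $t/p$ the subterm at position $p$, $t[s]_p$ the result of replacing it by $s$. A substitution $\sigma$ maps variables to terms (finite domain) and is extended homomorphically; $t\sigma$ is its application. A rewrite rule $l\to r$ is a pair of terms with $l$ not a variable and $\mathcal{V}(r)\subseteq\mathcal{V}(l)$; a TRS is a finite set of rewrite rules; $s\to_{\mathcal{R}} t$ iff $s/p = l\sigma$ and $t = s[r\sigma]_p$ for some rule $l\to r\in\mathcal{R}$, position $p$ and substitution $\sigma$. $\mathcal{R}^{-1}=\{r\to l\mid l\to r\in\mathcal{R}\}$ (rewriting with it is defined the same way). A term is linear if no variable occurs twice; a rule is linear if both sides are linear; a TRS is linear if all its rules are. A TRS $\mathcal{R}$ is reversible if $s\to_{\mathcal{R}}t$ implies $t\stackrel{*}{\to}_{\mathcal{R}} s$. $\mathcal{R}$ is confluent if ${\stackrel{*}{\gets}_{\mathcal{R}}}\circ{\stackrel{*}{\to}_{\mathcal{R}}} \subseteq {\stackrel{*}{\to}_{\mathcal{R}}}\circ{\stackrel{*}{\gets}_{\mathcal{R}}}$. $\mathcal{S}$ is terminating relative to $\mathcal{P}'$ if ${\to_{\mathcal{S}}}\circ{\stackrel{*}{\to}_{\mathcal{P}'}}$ is well-founded (no infinite chain). Critical pairs: given rules $l_1\to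 r_1\in\mathcal{R}$ and $l_2\to r_2\in\mathcal{Q}$ renamed to have disjoint variables, a non-variable position $p$ of $l_2$ such that $l_1$ and $l_2/p$ are unifiable with mgu $\sigma$ (excluding $p=\epsilon$ when the two rules are the same up to renaming), the pair $\langle l_2[r_1]_p\sigma, r_2\sigma\rangle$ is a critical pair; $\mathrm{CP}(\mathcal{R},\mathcal{Q})$ is the set of all such pairs. For a set $C$ of pairs and a relation $R$, $C\subseteq R$ means $u\,R\,v$ for every $\langle u,v\rangle\in C$. Relation notation: $\gets$ inverse, $\stackrel{=}{}$ reflexive closure, $\stackrel{*}{}$ reflexive-transitive closure, $\circ$ composition ($a\,(R\circ S)\,c$ iff $\exists b$, $a\,R\,b$, $b\,S\,c$). *)

theory Defs
  imports Main "HOL-Library.Confluence"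
begin

datatype (funs: 'f, vars: 'v) trm = Var 'v | Fun 'f "('f, 'v) trm list"

type_synonym ('f, 'v) rule = "('f, 'v) trm \<times> ('f, 'v) trm"
type_synonym ('f, 'v) sbst = "'v \<Rightarrow> ('f, 'v) trm"

text \<open>A signature is a partial map F giving the arity of each of its function symbols; the
  datatype itself does not enforce arities.\<close>

primrec wf_trm :: "('f \<rightharpoonup> nat) \<Rightarrow> ('f, 'v) trm \<Rightarrow> bool" where
  "wf_trm F (Var x) \<longleftrightarrow> True"
| "wf_trm F (Fun f ts) \<longleftrightarrow> F f = Some (length ts) \<and> list_all (wf_trm F) ts"

lemma size_nth_less [termination_simp]: "i < length ts \<Longrightarrow> size (ts ! i) < Suc (size_list size ts)"
  by (simp add: less_Suc_eq_le size_list_estimation'[OF nth_mem])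

fun poss :: "('f, 'v) trm \<Rightarrow> nat list set" where
  "poss (Var x) = {[]}"
| "poss (Fun f ts) = {[]} \<union> (\<Union>i\<in>{..<length ts}. (#) i ` poss (ts ! i))"

text \<open>The next two functions are meaningful only for positions of the given term.\<close>

fun subt_at :: "('f, 'v) trm \<Rightarrow> nat list \<Rightarrow> ('f, 'v) trm" where
  "subt_at t [] = t"
| "subt_at (Fun f ts) (i # p) = subt_at (ts ! i) p"
| "subt_at (Var x) (i # p) = undefined"

fun replace_at :: "('f, 'v) trm \<Rightarrow> nat list \<Rightarrow> ('f, 'v) trm \<Rightarrow> ('f, 'v) trm" where
  "replace_at t [] s = s"
| "replace_at (Fun f ts) (i # p) s = Fun f (ts[i := replace_at (ts ! i) p s])"
| "replace_at (Var x) (i # p) s = undefined"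

primrec sbst_apply :: "('f, 'v) trm \<Rightarrow> ('f, 'v) sbst \<Rightarrow> ('f, 'v) trm" (infixl \<open>\<cdot>\<close> 67) where
  "Var x \<cdot> \<sigma> = \<sigma> x"
| "Fun f ts \<cdot> \<sigma> = Fun f (map (\<lambda>t. t \<cdot> \<sigma>) ts)"

definition is_sbst :: "('f \<rightharpoonup> nat) \<Rightarrow> ('f, 'v) sbst \<Rightarrow> bool" where
  "is_sbst F \<sigma> \<longleftrightarrow> finite {x. \<sigma> x \<noteq> Var x} \<and> (\<forall>x. wf_trm F (\<sigma> x))"

definition trs :: "('f \<rightharpoonup> nat) \<Rightarrow> ('f, 'v) rule set \<Rightarrow> bool" where
  "trs F R \<longleftrightarrow> finite R \<and>
     (\<forall>(l, r)\<in>R. wf_trm F l \<and> wf_trm F r \<and> (\<forall>x. l \<noteq> Var x) \<and> vars r \<subseteq> vars l)"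

text \<open>Rewriting is defined for arbitrary sets of pairs of terms, so that it also applies to the
  converse of a TRS, which need not be a TRS.\<close>

definition rstep :: "('f \<rightharpoonup> nat) \<Rightarrow> ('f, 'v) rule set \<Rightarrow> ('f, 'v) trm rel" where
  "rstep F R = {(s, t). wf_trm F s \<and>
     (\<exists>l r p \<sigma>. (l, r) \<in> R \<and> p \<in> poss s \<and> is_sbst F \<sigma> \<and>
        subt_at s p = l \<cdot> \<sigma> \<and> t = replace_at s p (r \<cdot> \<sigma>))}"

definition linear_trm :: "('f, 'v) trm \<Rightarrow> bool" where
  "linear_trm t \<longleftrightarrow>
     (\<forall>p\<in>poss t. \<forall>q\<in>poss t. \<forall>x. subt_at t p = Var x \<and> subt_at t q = Var x \<longrightarrow> p = q)"

definition linear_trs :: "('f, 'v) rule set \<Rightarrow> bool" where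
  "linear_trs R \<longleftrightarrow> (\<forall>(l, r)\<in>R. linear_trm l \<and> linear_trm r)"

definition reversible :: "('f \<rightharpoonup> nat) \<Rightarrow> ('f, 'v) rule set \<Rightarrow> bool" where
  "reversible F R \<longleftrightarrow> (\<forall>s t. (s, t) \<in> rstep F R \<longrightarrow> (t, s) \<in> (rstep F R)\<^sup>*)"

text \<open>The converse is needed because \<^const>\<open>wf\<close> excludes infinite descending chains.\<close>

definition rel_terminating ::
    "('f \<rightharpoonup> nat) \<Rightarrow> ('f, 'v) rule set \<Rightarrow> ('f, 'v) rule set \<Rightarrow> bool" where
  "rel_terminating F S P \<longleftrightarrow> wf ((rstep F S O (rstep F P)\<^sup>*)\<inverse>)"

definition confluent :: "('f \<rightharpoonup> nat) \<Rightarrow> ('f, 'v) rule set \<Rightarrow> bool" where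
  "confluent F R \<longleftrightarrow> confluentp (\<lambda>s t. (s, t) \<in> rstep F R)"

fun variant :: "('f, 'v) rule \<Rightarrow> ('f, 'v) rule \<Rightarrow> bool" where
  "variant (l, r) (l', r') \<longleftrightarrow>
     (\<exists>\<pi>. inj_on \<pi> (vars l \<union> vars r) \<and> l' = map_trm id \<pi> l \<and> r' = map_trm id \<pi> r)"

definition is_mgu ::
    "('f \<rightharpoonup> nat) \<Rightarrow> ('f, 'v) sbst \<Rightarrow> ('f, 'v) trm \<Rightarrow> ('f, 'v) trm \<Rightarrow> bool" where
  "is_mgu F \<sigma> s t \<longleftrightarrow> is_sbst F \<sigma> \<and> s \<cdot> \<sigma> = t \<cdot> \<sigma> \<and>
     (\<forall>\<tau>. is_sbst F \<tau> \<and> s \<cdot> \<tau> = t \<cdot> \<tau> \<longrightarrow>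
        (\<exists>\<gamma>. is_sbst F \<gamma> \<and> (\<forall>x. \<tau> x = \<sigma> x \<cdot> \<gamma>)))"

text \<open>Instead of fixing one renaming of the rules and one mgu per overlap, all of them are
  admitted, so the set of critical pairs is closed under renaming of variables.\<close>

definition CP ::
    "('f \<rightharpoonup> nat) \<Rightarrow> ('f, 'v) rule set \<Rightarrow> ('f, 'v) rule set \<Rightarrow> ('f, 'v) trm rel" where
  "CP F R Q = {(replace_at l2 p r1 \<cdot> \<sigma>, r2 \<cdot> \<sigma>) | l1 r1 l2 r2 p \<sigma>.
     (\<exists>\<rho>\<in>R. variant \<rho> (l1, r1)) \<and> (\<exists>\<rho>\<in>Q. variant \<rho> (l2, r2)) \<and>
     (vars l1 \<union> vars r1) \<inter> (vars l2 \<union> vars r2) = {} \<and>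
     p \<in> poss l2 \<and> (\<forall>x. subt_at l2 p \<noteq> Var x) \<and>
     \<not> (p = [] \<and> variant (l1, r1) (l2, r2)) \<and>
     is_mgu F \<sigma> l1 (subt_at l2 p)}"

end

theory Submission
  imports Defs "HOL-Library.Multiset"
begin

text \<open>Write \<open>H\<close> for the symmetric rewrite relation of the union of \<open>P\<close> and its converse; as
  \<open>P\<close> is reversible, \<open>H\<close> is contained in the reflexive-transitive closure of the rewrite
  relation of \<open>P\<close>, so it suffices to turn every conversion by \<open>S\<close> and \<open>H\<close> into a valley.
  Because \<open>S\<close> is linear, non-critical local peaks can be joined in the same shapes as the
  critical pairs. Weighing a conversion by the multiset of the terms on it, ordered by relative
  termination, replacing a local peak by its joining conversion decreases the weight.\<close>

subsection \<open>Conversions modulo a symmetric relation\<close>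

lemma mult_add_left: "(A, B) \<in> mult r \<Longrightarrow> (C + A, C + B) \<in> mult r"
  unfolding mult_def
  by (induction rule: trancl_induct) (auto intro: mult1_union trancl_into_trancl)

lemma mult_add_mset: "(A, B) \<in> mult r \<Longrightarrow> (add_mset x A, add_mset x B) \<in> mult r"
  using mult_add_left[of A B r "{#x#}"] by simp

lemma wf_relative_trancl:
  assumes "wf ((S O I\<^sup>*)\<inverse>)"
  shows "wf ((I\<^sup>* O (S O I\<^sup>*)\<^sup>+)\<inverse>)"
proof (rule wfI_min)
  fix x Q assume "x \<in> (Q :: 'a set)"
  let ?A = "(S O I\<^sup>*)\<^sup>+"
  have absorb: "?A O I\<^sup>* \<subseteq> ?A"
  proof clarify
    fix a b c assume "(a, b) \<in> ?A" "(b, c) \<in> I\<^sup>*"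
    then show "(a, c) \<in> ?A"
      by (induction rule: trancl_induct) (auto intro: trancl_into_trancl rtrancl_trans)
  qed
  have wfA: "wf (?A\<inverse>)"
    using wf_trancl[OF assms] by (simp add: trancl_converse)
  show "\<exists>z\<in>Q. \<forall>y. (y, z) \<in> (I\<^sup>* O ?A)\<inverse> \<longrightarrow> y \<notin> Q"
  proof (rule ccontr)
    assume "\<not> ?thesis"
    then have step: "\<exists>u y. y \<in> Q \<and> (z, u) \<in> I\<^sup>* \<and> (u, y) \<in> ?A" if "z \<in> Q" for z
      using that by blast
    define T where "T = {u. \<exists>z\<in>Q. \<exists>y\<in>Q. (z, u) \<in> I\<^sup>* \<and> (u, y) \<in> ?A}"
    obtain u where "u \<in> T" using step[OF \<open>x \<in> Q\<close>] \<open>x \<in> Q\<close> unfolding T_def by blast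
    then obtain m where m: "m \<in> T" "\<And>y. (y, m) \<in> ?A\<inverse> \<Longrightarrow> y \<notin> T"
      using wfE_min[OF wfA] by metis
    then obtain y where y: "y \<in> Q" "(m, y) \<in> ?A" unfolding T_def by blast
    obtain u' y' where "y' \<in> Q" "(y, u') \<in> I\<^sup>*" "(u', y') \<in> ?A" using step[OF y(1)] by blast
    then have "u' \<in> T" "(m, u') \<in> ?A" using y absorb unfolding T_def by blast+
    then show False using m(2) by blast
  qed
qed

locale peaks_modulo =
  fixes S H I :: "'a rel"
  assumes sym_H: "sym H" and I_sub_H: "I \<subseteq> H"
    and wf_S_rel_I: "wf ((S O I\<^sup>*)\<inverse>)"
    and peak_SS: "(c, a) \<in> S \<Longrightarrow> (c, b) \<in> S \<Longrightarrow>
      \<exists>d e. (a, d) \<in> (S \<union> I)\<^sup>* \<and> (d, e) \<in> H\<^sup>= \<and> (b, e) \<in> (S \<union> I)\<^sup>*"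
    and peak_HS: "(a, c) \<in> H \<Longrightarrow> (c, b) \<in> S \<Longrightarrow>
      (\<exists>e. (a, e) \<in> H\<^sup>= \<and> (b, e) \<in> (S \<union> I)\<^sup>*) \<or>
      (\<exists>a' d e. (a, a') \<in> S \<and> (a', d) \<in> (S \<union> I)\<^sup>* \<and> (d, e) \<in> H\<^sup>= \<and> (b, e) \<in> (S \<union> I)\<^sup>*)"
begin

definition gt :: "'a rel" where
  "gt = I\<^sup>* O (S O I\<^sup>*)\<^sup>+"

lemma S_sub_gt: "S \<subseteq> gt"
  unfolding gt_def by auto

lemma gt_steps:
  assumes "(b, e) \<in> (S \<union> I)\<^sup>*" "(c, b) \<in> gt"
  shows "(c, e) \<in> gt"
  using assms
proof (induction rule: rtrancl_induct)
  case (step y z)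
  then obtain x where x: "(c, x) \<in> I\<^sup>*" "(x, y) \<in> (S O I\<^sup>*)\<^sup>+" unfolding gt_def by blast
  have "(x, z) \<in> (S O I\<^sup>*)\<^sup>+"
  proof (cases "(y, z) \<in> S")
    case True
    then show ?thesis using x(2) by (auto intro: trancl_into_trancl)
  next
    case False
    then have "(y, z) \<in> I" using step by blast
    from x(2) this show ?thesis
      by (induction rule: trancl_induct)
        (auto intro: trancl_into_trancl rtrancl_into_rtrancl)
  qed
  then show ?case unfolding gt_def using x(1) by blast
qed

definition lab :: "('a \<times> nat) rel" where
  "lab = gt\<inverse> <*lex*> less_than"

lemma wf_lab: "wf lab"
  unfolding lab_def gt_def using wf_relative_trancl[OF wf_S_rel_I] by auto

text \<open>Conversions with a multiset of labels and the kind of their first step (forward 0,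
  symmetric 1, backward 2, none 3). An \<^term>\<open>S\<close>-step from \<^term>\<open>a\<close> must weigh less
  than an \<^term>\<open>H\<close>-step at \<^term>\<open>a\<close>, and more than any step at an element below
  \<^term>\<open>a\<close>: a peak of \<^term>\<open>H\<close> against \<^term>\<open>S\<close> moves the \<^term>\<open>S\<close>-step to the
  other end of the \<^term>\<open>H\<close>-step, whose element need not be comparable.\<close>

inductive conv :: "('a \<times> nat) multiset \<Rightarrow> nat \<Rightarrow> 'a \<Rightarrow> 'a \<Rightarrow> bool" where
  refl: "conv {#} 3 a a"
| fwd: "(a, b) \<in> S \<Longrightarrow> conv M k b c \<Longrightarrow> conv (add_mset (a, 0) M) 0 a c"
| sym: "(a, b) \<in> H \<Longrightarrow> conv M k b c \<Longrightarrow> conv (add_mset (a, 1) (add_mset (b, 1) M)) 1 a c"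
| bwd: "(b, a) \<in> S \<Longrightarrow> conv M k b c \<Longrightarrow> conv (add_mset (b, 0) M) 2 a c"

lemma conv_0D:
  "conv M 0 a c \<Longrightarrow> \<exists>b N k. (a, b) \<in> S \<and> conv N k b c \<and> M = add_mset (a, 0) N"
  by (erule conv.cases; (linarith | blast))

lemma conv_1D:
  "conv M 1 a c \<Longrightarrow> \<exists>b N k. (a, b) \<in> H \<and> conv N k b c \<and> M = add_mset (a, 1) (add_mset (b, 1) N)"
  by (erule conv.cases; (linarith | blast))

lemma conv_append:
  "conv M k a b \<Longrightarrow> conv N j b d \<Longrightarrow> \<exists>i. conv (M + N) i a d"
proof (induction rule: conv.induct)
  case (fwd a b M k c)
  then obtain i where "conv (M + N) i b d" by blast
  from conv.fwd[OF fwd(1) this] show ?case by auto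
next
  case (sym a b M k c)
  then obtain i where "conv (M + N) i b d" by blast
  from conv.sym[OF sym(1) this] show ?case by auto
next
  case (bwd b a M k c)
  then obtain i where "conv (M + N) i b d" by blast
  from conv.bwd[OF bwd(1) this] show ?case by auto
qed auto

lemma conv_rev: "conv M k a b \<Longrightarrow> \<exists>i. conv M i b a"
proof (induction rule: conv.induct)
  case (refl a)
  show ?case using conv.refl by blast
next
  case (fwd a b M k c)
  then obtain i where "conv M i c b" by blast
  from conv_append[OF this conv.bwd[OF fwd(1) conv.refl]] show ?case by simp
next
  case (sym a b M k c)
  then obtain i where "conv M i c b" by blast
  from conv_append[OF this conv.sym[OF symD[OF sym_H sym(1)] conv.refl]]
  show ?case by (simp add: add_mset_commute)
next
  case (bwd b a M k c)
  then obtain i where "conv M i c b" by blast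
  from conv_append[OF this conv.fwd[OF bwd(1) conv.refl]] show ?case by simp
qed

lemma conv_descend:
  assumes "(b, e) \<in> (S \<union> I)\<^sup>*" "(c, b) \<in> gt"
  shows "\<exists>M k. conv M k b e \<and> (\<forall>m\<in>#M. (c, fst m) \<in> gt)"
  using assms
proof (induction rule: converse_rtrancl_induct)
  case base
  show ?case by (rule exI[of _ "{#}"]) (use conv.refl in auto)
next
  case (step x y)
  then have "(c, y) \<in> gt" using gt_steps by blast
  with step obtain M k where M: "conv M k y e" "\<forall>m\<in>#M. (c, fst m) \<in> gt" by blast
  consider "(x, y) \<in> S" | "(x, y) \<in> H" using step(1) I_sub_H by blast
  then show ?case
  proof cases
    case 1
    show ?thesis using conv.fwd[OF 1 M(1)] M(2) step(4)
      by (intro exI[of _ "add_mset (x, 0) M"] exI[of _ 0]) auto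
  next
    case 2
    show ?thesis using conv.sym[OF 2 M(1)] M(2) step(4) \<open>(c, y) \<in> gt\<close>
      by (intro exI[of _ "add_mset (x, 1) (add_mset (y, 1) M)"] exI[of _ 1]) auto
  qed
qed

lemma conv_H_descend:
  assumes "(d, e) \<in> H\<^sup>=" "(b, e) \<in> (S \<union> I)\<^sup>*" "(c, b) \<in> gt"
  shows "\<exists>M L k. conv (L + M) k d b \<and> (\<forall>m\<in>#M. (c, fst m) \<in> gt) \<and> L \<subseteq># {#(d, 1)#}"
proof -
  obtain M k where "conv M k b e" and M: "\<forall>m\<in>#M. (c, fst m) \<in> gt"
    using conv_descend[OF assms(2,3)] by blast
  then obtain j where j: "conv M j e b" using conv_rev by blast
  show ?thesis
  proof (cases "d = e")
    case True
    with j M show ?thesis by (intro exI[of _ M] exI[of _ "{#}"]) auto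
  next
    case False
    then have "conv ({#(d, 1)#} + add_mset (e, 1) M) 1 d b"
      using assms(1) conv.sym[OF _ j, of d] by (simp add: add_mset_commute)
    then show ?thesis using M gt_steps[OF assms(2,3)]
      by (intro exI[of _ "add_mset (e, 1) M"] exI[of _ "{#(d, 1)#}"]) auto
  qed
qed

lemma conv_valley:
  assumes "(a, d) \<in> (S \<union> I)\<^sup>*" "(d, e) \<in> H\<^sup>=" "(b, e) \<in> (S \<union> I)\<^sup>*"
    and "(c, a) \<in> gt" "(c', b) \<in> gt"
  shows "\<exists>M k. conv M k a b \<and> (\<forall>m\<in>#M. (c, fst m) \<in> gt \<or> (c', fst m) \<in> gt)"
proof -
  obtain M L k where 1: "conv (L + M) k d b" "\<forall>m\<in>#M. (c', fst m) \<in> gt" "L \<subseteq># {#(d, 1)#}"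
    using conv_H_descend[OF assms(2,3,5)] by blast
  obtain N j where 2: "conv N j a d" "\<forall>m\<in>#N. (c, fst m) \<in> gt"
    using conv_descend[OF assms(1,4)] by blast
  have "\<forall>m\<in>#L. (c, fst m) \<in> gt"
    using 1(3) gt_steps[OF assms(1,4)] by (auto dest: mset_subset_eqD)
  then show ?thesis using conv_append[OF 2(1) 1(1)] 1(2) 2(2)
    by (metis union_iff)
qed

lemma reduce_SS:
  assumes "(c, a) \<in> S" "(c, b) \<in> S"
  shows "\<exists>K k. conv K k a b \<and> (K, {#(c, 0), (c, 0)#}) \<in> mult lab"
proof -
  obtain d e where "(a, d) \<in> (S \<union> I)\<^sup>*" "(d, e) \<in> H\<^sup>=" "(b, e) \<in> (S \<union> I)\<^sup>*"
    using peak_SS[OF assms] by blast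
  then obtain K k where K: "conv K k a b" "\<forall>m\<in>#K. (c, fst m) \<in> gt"
    using conv_valley[of a d e b c c] S_sub_gt assms by blast
  have "({#} + K, {#} + {#(c, 0), (c, 0)#}) \<in> mult lab"
    using K(2) by (intro one_step_implies_mult) (auto simp: lab_def)
  then show ?thesis using K(1) by auto
qed

lemma reduce_HS:
  assumes "(a, c) \<in> H" "(c, b) \<in> S"
  shows "\<exists>K k. conv K k a b \<and> (K, {#(a, 1), (c, 1), (c, 0)#}) \<in> mult lab"
proof -
  have cb: "(c, b) \<in> gt" using assms S_sub_gt by blast
  consider e where "(a, e) \<in> H\<^sup>=" "(b, e) \<in> (S \<union> I)\<^sup>*"
    | a' d e where "(a, a') \<in> S"
      "(a', d) \<in> (S \<union> I)\<^sup>*" "(d, e) \<in> H\<^sup>=" "(b, e) \<in> (S \<union> I)\<^sup>*"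
    using peak_HS[OF assms] by blast
  then show ?thesis
  proof cases
    case 1
    then obtain M L k where
      *: "conv (L + M) k a b" "\<forall>m\<in>#M. (c, fst m) \<in> gt" "L \<subseteq># {#(a, 1)#}"
      using conv_H_descend[OF 1 cb] by blast
    obtain L' where L': "{#(a, 1)#} = L + L'" using *(3) by (auto simp: mset_subset_eq_exists_conv)
    have "(L + M, L + (L' + {#(c, 1), (c, 0)#})) \<in> mult lab"
      using *(2) by (intro one_step_implies_mult) (auto simp: lab_def)
    moreover have "{#(a, 1), (c, 1), (c, 0)#} = L + (L' + {#(c, 1), (c, 0)#})"
      using L' by (simp add: union_assoc[symmetric])
    ultimately show ?thesis using *(1) by metis
  next
    case 2
    then obtain K k where
      K: "conv K k a' b" "\<forall>m\<in>#K. (a, fst m) \<in> gt \<or> (c, fst m) \<in> gt"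
      using conv_valley[of a' d e b a c] cb S_sub_gt by blast
    have "({#} + add_mset (a, 0) K, {#} + {#(a, 1), (c, 1), (c, 0)#}) \<in> mult lab"
      using K(2) by (intro one_step_implies_mult) (auto simp: lab_def)
    then show ?thesis using conv.fwd[OF 2(1) K(1)] by auto
  qed
qed

definition valley :: "nat \<Rightarrow> 'a rel" where
  "valley k = (if k = 0 then S\<^sup>* else Id) O (if k \<le> 1 then H\<^sup>* else Id) O
     (if k \<le> 2 then (S\<inverse>)\<^sup>* else Id)"

lemma reduce_context:
  assumes "(K, J) \<in> mult lab" "conv K i a b" "conv M k b c"
  shows "\<exists>M' k'. (M', J + M) \<in> mult lab \<and> conv M' k' a c"
  using conv_append[OF assms(2,3)] mult_add_left[OF assms(1), of M]
  by (metis union_commute)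

lemma conv_reduce_or_valley:
  "conv M k a c \<Longrightarrow> (\<exists>M' k'. (M', M) \<in> mult lab \<and> conv M' k' a c) \<or> (a, c) \<in> valley k"
proof (induction rule: conv.induct)
  case (refl a)
  then show ?case by (auto simp: valley_def)
next
  case (fwd a b M k c)
  from fwd(3) show ?case
  proof (elim disjE exE conjE)
    fix M' k' assume "(M', M) \<in> mult lab" "conv M' k' b c"
    from mult_add_mset[OF this(1)] conv.fwd[OF fwd(1) this(2)]
    show ?thesis by (metis)
  next
    assume "(b, c) \<in> valley k"
    then have "(b, c) \<in> valley 0" by (force simp: valley_def split: if_splits)
    then have "(a, c) \<in> valley 0" using fwd(1)
      by (auto simp: valley_def intro: converse_rtrancl_into_rtrancl)
    then show ?thesis by blast
  qed
next
  case (sym a b M k c)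
  from sym(3) show ?case
  proof (elim disjE exE conjE)
    fix M' k' assume "(M', M) \<in> mult lab" "conv M' k' b c"
    from mult_add_mset[OF this(1)] conv.sym[OF sym(1) this(2)]
    show ?thesis by (metis mult_add_mset)
  next
    assume v: "(b, c) \<in> valley k"
    show ?thesis
    proof (cases "k = 0")
      case True
      with sym(2) have "conv M 0 b c" by simp
      then obtain b' M0 k0 where 1: "(b, b') \<in> S" "conv M0 k0 b' c" "M = add_mset (b, 0) M0"
        using conv_0D by blast
      obtain K i where "conv K i a b'" "(K, {#(a, 1), (b, 1), (b, 0)#}) \<in> mult lab"
        using reduce_HS[OF sym(1) 1(1)] by blast
      from reduce_context[OF this(2,1) 1(2)] show ?thesis unfolding 1(3) by simp
    next
      case False
      then have "(b, c) \<in> valley 1" using v by (force simp: valley_def split: if_splits)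
      then have "(a, c) \<in> valley 1" using sym(1)
        by (auto simp: valley_def intro: converse_rtrancl_into_rtrancl)
      then show ?thesis by blast
    qed
  qed
next
  case (bwd b a M k c)
  from bwd(3) show ?case
  proof (elim disjE exE conjE)
    fix M' k' assume "(M', M) \<in> mult lab" "conv M' k' b c"
    from mult_add_mset[OF this(1)] conv.bwd[OF bwd(1) this(2)]
    show ?thesis by (metis)
  next
    assume v: "(b, c) \<in> valley k"
    consider "k = 0" | "k = 1" | "k > 1" by linarith
    then show ?thesis
    proof cases
      case 1
      with bwd(2) have "conv M 0 b c" by simp
      then obtain b' M0 k0 where 1: "(b, b') \<in> S" "conv M0 k0 b' c" "M = add_mset (b, 0) M0"
        using conv_0D by blast
      obtain K i where "conv K i a b'" "(K, {#(b, 0), (b, 0)#}) \<in> mult lab"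
        using reduce_SS[OF bwd(1) 1(1)] by blast
      from reduce_context[OF this(2,1) 1(2)] show ?thesis unfolding 1(3) by simp
    next
      case 2
      with bwd(2) have "conv M 1 b c" by simp
      then obtain b' M0 k0 where
        1: "(b, b') \<in> H" "conv M0 k0 b' c" "M = add_mset (b, 1) (add_mset (b', 1) M0)"
        using conv_1D by blast
      obtain K i where "conv K i b' a" and K: "(K, {#(b', 1), (b, 1), (b, 0)#}) \<in> mult lab"
        using reduce_HS[OF symD[OF sym_H 1(1)] bwd(1)] by blast
      then obtain j where "conv K j a b'" using conv_rev by blast
      from reduce_context[OF K this 1(2)]
      show ?thesis by (simp add: 1(3) add_mset_commute)
    next
      case 3
      then have "(b, c) \<in> valley 2" using v by (force simp: valley_def split: if_splits)
      then have "(a, c) \<in> valley 2" using bwd(1)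
        by (auto simp: valley_def intro: converse_rtrancl_into_rtrancl)
      then show ?thesis by blast
    qed
  qed
qed

lemma conv_imp_valley: "conv M k a c \<Longrightarrow> (a, c) \<in> S\<^sup>* O H\<^sup>* O (S\<inverse>)\<^sup>*"
proof (induction M arbitrary: k rule: wf_induct_rule[OF wf_mult[OF wf_lab]])
  case (1 M)
  have "(a, c) \<in> valley k \<Longrightarrow> ?case"
    by (force simp: valley_def split: if_splits)
  with conv_reduce_or_valley[OF 1(2)] 1(1) show ?case by metis
qed

lemma steps_imp_conv: "(a, b) \<in> (S \<union> H)\<^sup>* \<Longrightarrow> \<exists>M k. conv M k a b"
proof (induction rule: converse_rtrancl_induct)
  case base
  then show ?case using conv.refl by blast
next
  case (step a b)
  then show ?case using conv.fwd conv.sym by blast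
qed

lemma peak_imp_valley:
  assumes "(c, a) \<in> (S \<union> H)\<^sup>*" "(c, b) \<in> (S \<union> H)\<^sup>*"
  shows "\<exists>d. (a, d) \<in> (S \<union> H)\<^sup>* \<and> (b, d) \<in> (S \<union> H)\<^sup>*"
proof -
  obtain M k where "conv M k a b"
    using steps_imp_conv[OF assms(1)] steps_imp_conv[OF assms(2)] conv_rev conv_append by meson
  from conv_imp_valley[OF this] obtain d e where "(a, d) \<in> S\<^sup>*" "(d, e) \<in> H\<^sup>*" "(b, e) \<in> S\<^sup>*"
    by (auto simp: rtrancl_converse)
  then have "(a, d) \<in> (S \<union> H)\<^sup>*" "(d, e) \<in> (S \<union> H)\<^sup>*" "(b, e) \<in> (S \<union> H)\<^sup>*"
    using rtrancl_mono[of S "S \<union> H"] rtrancl_mono[of H "S \<union> H"] by blast+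
  then show ?thesis by (meson rtrancl_trans)
qed

end

subsection \<open>Terms, positions and substitutions\<close>

lemma sbst_cong_iff: "t \<cdot> \<sigma> = t \<cdot> \<tau> \<longleftrightarrow> (\<forall>x\<in>vars t. \<sigma> x = \<tau> x)"
  by (induction t) auto

lemma sbst_cong: "(\<And>x. x \<in> vars t \<Longrightarrow> \<sigma> x = \<tau> x) \<Longrightarrow> t \<cdot> \<sigma> = t \<cdot> \<tau>"
  by (simp add: sbst_cong_iff)

lemma sbst_Var [simp]: "t \<cdot> Var = t"
  by (induction t) (auto intro: map_idI)

lemma sbst_sbst: "t \<cdot> \<sigma> \<cdot> \<tau> = t \<cdot> (\<lambda>x. \<sigma> x \<cdot> \<tau>)"
  by (induction t) auto

lemma vars_sbst: "vars (t \<cdot> \<sigma>) = (\<Union>x\<in>vars t. vars (\<sigma> x))"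
  by (induction t) auto

lemma finite_vars [simp]: "finite (vars t)"
  by (induction t) auto

lemma map_trm_sbst: "map_trm id \<pi> t = t \<cdot> (\<lambda>x. Var (\<pi> x))"
  by (induction t) auto

lemma wf_trm_sbst_iff: "wf_trm F (t \<cdot> \<sigma>) \<longleftrightarrow> wf_trm F t \<and> (\<forall>x\<in>vars t. wf_trm F (\<sigma> x))"
  by (induction t) (auto simp: list_all_iff)

lemma wf_trm_is_sbst: "is_sbst F \<sigma> \<Longrightarrow> wf_trm F t \<Longrightarrow> wf_trm F (t \<cdot> \<sigma>)"
  by (simp add: wf_trm_sbst_iff is_sbst_def)

lemma is_sbst_Var: "is_sbst F Var"
  by (simp add: is_sbst_def)

lemma is_sbst_comp:
  assumes "is_sbst F \<sigma>" "is_sbst F \<tau>"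
  shows "is_sbst F (\<lambda>x. \<sigma> x \<cdot> \<tau>)"
proof -
  have "{x. \<sigma> x \<cdot> \<tau> \<noteq> Var x} \<subseteq> {x. \<sigma> x \<noteq> Var x} \<union> {x. \<tau> x \<noteq> Var x}" by auto
  from finite_subset[OF this] show ?thesis using assms
    by (auto simp: is_sbst_def wf_trm_sbst_iff)
qed

lemma is_sbst_upd:
  assumes "is_sbst F \<sigma>" "wf_trm F u"
  shows "is_sbst F (\<sigma>(x := u))"
proof -
  have "{y. (\<sigma>(x := u)) y \<noteq> Var y} \<subseteq> insert x {y. \<sigma> y \<noteq> Var y}" by auto
  from finite_subset[OF this] show ?thesis using assms by (simp add: is_sbst_def)
qed

lemma Nil_in_poss [simp]: "[] \<in> poss t"
  by (cases t) auto

lemma poss_sbst: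
  "p \<in> poss t \<Longrightarrow> p \<in> poss (t \<cdot> \<sigma>) \<and> subt_at (t \<cdot> \<sigma>) p = subt_at t p \<cdot> \<sigma>"
  by (induction t p rule: subt_at.induct) auto

lemma replace_at_sbst:
  "p \<in> poss t \<Longrightarrow> replace_at t p s \<cdot> \<sigma> = replace_at (t \<cdot> \<sigma>) p (s \<cdot> \<sigma>)"
  by (induction t p rule: subt_at.induct) (auto simp: map_update)

lemma replace_at_subt_at: "p \<in> poss t \<Longrightarrow> replace_at t p (subt_at t p) = t"
  by (induction t p rule: subt_at.induct) auto

lemma subt_at_append: "p \<in> poss t \<Longrightarrow> subt_at t (p @ q) = subt_at (subt_at t p) q"
  by (induction t p rule: subt_at.induct) auto

lemma replace_at_append:
  "p \<in> poss t \<Longrightarrow> replace_at t (p @ q) s = replace_at t p (replace_at (subt_at t p) q s)"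
  by (induction t p rule: subt_at.induct) auto

lemma wf_trm_subt_at: "p \<in> poss t \<Longrightarrow> wf_trm F t \<Longrightarrow> wf_trm F (subt_at t p)"
  by (induction t p rule: subt_at.induct) (auto simp: list_all_length)

lemma wf_trm_replace_at:
  "p \<in> poss t \<Longrightarrow> wf_trm F t \<Longrightarrow> wf_trm F s \<Longrightarrow> wf_trm F (replace_at t p s)"
  by (induction t p rule: subt_at.induct) (auto simp: list_all_length nth_list_update)

lemma vars_iff_poss: "x \<in> vars t \<longleftrightarrow> (\<exists>p\<in>poss t. subt_at t p = Var x)"
proof (induction t)
  case (Fun f ts)
  show ?case
  proof
    assume "x \<in> vars (Fun f ts)"
    then obtain i where i: "i < length ts" "x \<in> vars (ts ! i)" by (auto simp: in_set_conv_nth)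
    with Fun obtain p where "p \<in> poss (ts ! i)" "subt_at (ts ! i) p = Var x" by auto
    then show "\<exists>p\<in>poss (Fun f ts). subt_at (Fun f ts) p = Var x"
      using i by (intro bexI[of _ "i # p"]) auto
  next
    assume "\<exists>p\<in>poss (Fun f ts). subt_at (Fun f ts) p = Var x"
    then show "x \<in> vars (Fun f ts)" using Fun by fastforce
  qed
qed auto

lemma poss_sbst_cases:
  assumes "p \<in> poss (t \<cdot> \<sigma>)"
  obtains "p \<in> poss t" "\<And>x. subt_at t p \<noteq> Var x"
  | q q' x where "p = q @ q'" "q \<in> poss t" "subt_at t q = Var x" "q' \<in> poss (\<sigma> x)"
  using assms
proof (induction p arbitrary: t thesis)
  case Nil
  then show ?case by (cases t) force+
next
  case (Cons i p)
  show ?case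
  proof (cases t)
    case (Var x)
    then show ?thesis using Cons.prems(2)[of "[]" "i # p" x] Cons.prems(3) by simp
  next
    case (Fun f ts)
    then have i: "i < length ts" and p: "p \<in> poss (ts ! i \<cdot> \<sigma>)" using Cons.prems(3) by auto
    show ?thesis
    proof (rule Cons.IH[OF _ _ p])
      assume "p \<in> poss (ts ! i)" "\<And>x. subt_at (ts ! i) p \<noteq> Var x"
      then show ?thesis using i Fun by (intro Cons.prems(1)) auto
    next
      fix q q' x
      assume "p = q @ q'" "q \<in> poss (ts ! i)" "subt_at (ts ! i) q = Var x" "q' \<in> poss (\<sigma> x)"
      then show ?thesis using i Fun Cons.prems(2)[of "i # q" q' x] by auto
    qed
  qed
qed

lemma linear_trm_nth:
  assumes "linear_trm (Fun f ts)" "i < length ts"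
  shows "linear_trm (ts ! i)"
  unfolding linear_trm_def
proof (intro ballI allI impI)
  fix p q x
  assume "p \<in> poss (ts ! i)" "q \<in> poss (ts ! i)"
    "subt_at (ts ! i) p = Var x \<and> subt_at (ts ! i) q = Var x"
  moreover from this have "i # p \<in> poss (Fun f ts)" "i # q \<in> poss (Fun f ts)" using assms(2) by auto
  ultimately have "i # p = i # q"
    using assms(1) unfolding linear_trm_def by (metis subt_at.simps(2))
  then show "p = q" by simp
qed

lemma linear_trm_disjoint:
  assumes "linear_trm (Fun f ts)" "i < length ts" "j < length ts"
    and "x \<in> vars (ts ! i)" "x \<in> vars (ts ! j)"
  shows "i = j"
proof -
  obtain p where "p \<in> poss (ts ! i)" "subt_at (ts ! i) p = Var x"
    using assms(4) vars_iff_poss by metis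
  moreover obtain q where "q \<in> poss (ts ! j)" "subt_at (ts ! j) q = Var x"
    using assms(5) vars_iff_poss by metis
  moreover have "i # p \<in> poss (Fun f ts)" "j # q \<in> poss (Fun f ts)"
    using calculation assms(2,3) by auto
  ultimately have "i # p = j # q"
    using assms(1) unfolding linear_trm_def by (metis subt_at.simps(2))
  then show ?thesis by simp
qed

lemma replace_at_linear:
  "linear_trm t \<Longrightarrow> p \<in> poss t \<Longrightarrow> subt_at t p = Var x \<Longrightarrow> \<tau> = \<sigma>(x := u) \<Longrightarrow>
    replace_at (t \<cdot> \<sigma>) p u = t \<cdot> \<tau>"
proof (induction p arbitrary: t)
  case (Cons i p)
  then obtain f ts where t: "t = Fun f ts" by (cases t) auto
  then have i: "i < length ts" "p \<in> poss (ts ! i)" "subt_at (ts ! i) p = Var x"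
    using Cons.prems by auto
  have IH: "replace_at (ts ! i \<cdot> \<sigma>) p u = ts ! i \<cdot> \<tau>"
    using linear_trm_nth[of f ts i] Cons.prems(1,4) t i by (intro Cons.IH) simp_all
  have "x \<in> vars (ts ! i)" unfolding vars_iff_poss by (rule bexI[of _ p]) (fact i)+
  then have "x \<notin> vars (ts ! j)" if "j < length ts" "j \<noteq> i" for j
    using linear_trm_disjoint[of f ts i j x] that i(1) Cons.prems(1) t by auto
  then have "ts ! j \<cdot> \<sigma> = ts ! j \<cdot> \<tau>" if "j < length ts" "j \<noteq> i" for j
    using that Cons.prems(4) by (intro sbst_cong) auto
  then show ?case using IH i(1) by (auto simp: t nth_list_update intro!: nth_equalityI)
qed auto

subsection \<open>Unification\<close>

lemma size_sbst_var: "x \<in> vars t \<Longrightarrow> t \<noteq> Var x \<Longrightarrow> size (\<sigma> x) < size (t \<cdot> \<sigma>)"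
proof (induction t)
  case (Fun f ts)
  then obtain t where t: "t \<in> set ts" "x \<in> vars t" by auto
  have "size (\<sigma> x) \<le> size (t \<cdot> \<sigma>)" using Fun.IH[OF t] by (cases "t = Var x") auto
  also have "\<dots> < size (Fun f ts \<cdot> \<sigma>)"
    using t(1) by (auto simp: less_Suc_eq_le intro!: size_list_estimation')
  finally show ?case .
qed auto

definition unifies :: "('f, 'v) sbst \<Rightarrow> ('f, 'v) rule list \<Rightarrow> bool" where
  "unifies \<sigma> E \<longleftrightarrow> (\<forall>(s, t)\<in>set E. s \<cdot> \<sigma> = t \<cdot> \<sigma>)"

definition vars_eqs :: "('f, 'v) rule list \<Rightarrow> 'v set" where
  "vars_eqs E = (\<Union>(s, t)\<in>set E. vars s \<union> vars t)"

definition sbst_eqs :: "('f, 'v) rule list \<Rightarrow> ('f, 'v) sbst \<Rightarrow> ('f, 'v) rule list" where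
  "sbst_eqs E \<sigma> = map (\<lambda>(s, t). (s \<cdot> \<sigma>, t \<cdot> \<sigma>)) E"

text \<open>Idempotent most general unifiers: each unifier \<^term>\<open>\<tau>\<close> factors through
  \<^term>\<open>\<sigma>\<close> with \<^term>\<open>\<tau>\<close> itself as the second factor.\<close>

definition imgu :: "('f \<rightharpoonup> nat) \<Rightarrow> ('f, 'v) sbst \<Rightarrow> ('f, 'v) rule list \<Rightarrow> bool" where
  "imgu F \<sigma> E \<longleftrightarrow> is_sbst F \<sigma> \<and> unifies \<sigma> E \<and>
     (\<forall>\<tau>. unifies \<tau> E \<longrightarrow> (\<forall>x. \<tau> x = \<sigma> x \<cdot> \<tau>))"

lemma finite_vars_eqs [simp]: "finite (vars_eqs E)"
  by (auto simp: vars_eqs_def)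

lemma unifies_sbst_eqs: "unifies \<tau> (sbst_eqs E \<sigma>) \<longleftrightarrow> unifies (\<lambda>x. \<sigma> x \<cdot> \<tau>) E"
  by (auto simp: unifies_def sbst_eqs_def sbst_sbst)

lemma sbst_upd_absorb:
  assumes "\<tau> x = t \<cdot> \<tau>"
  shows "(\<lambda>y. (Var(x := t)) y \<cdot> \<tau>) = \<tau>"
  using assms by auto

lemma sbst_not_occurs: "x \<notin> vars t \<Longrightarrow> t \<cdot> Var(x := s) = t"
  using sbst_cong[of t "Var(x := s)" Var] by (metis fun_upd_other sbst_Var)

lemma imgu_elim:
  assumes "x \<notin> vars t" "wf_trm F t" "imgu F \<sigma> (sbst_eqs E (Var(x := t)))"
  shows "imgu F (\<lambda>y. (Var(x := t)) y \<cdot> \<sigma>) ((Var x, t) # E)"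
proof -
  let ?e = "Var(x := t)" let ?\<sigma> = "\<lambda>y. ?e y \<cdot> \<sigma>"
  have "is_sbst F ?\<sigma>"
    using assms(2,3) by (intro is_sbst_comp is_sbst_upd is_sbst_Var) (auto simp: imgu_def)
  moreover have "t \<cdot> ?\<sigma> = t \<cdot> \<sigma>"
    using sbst_not_occurs[OF assms(1), of t] by (simp only: sbst_sbst[symmetric])
  then have "unifies ?\<sigma> ((Var x, t) # E)"
    using assms(3) unfolding imgu_def unifies_sbst_eqs by (simp add: unifies_def)
  moreover have "\<tau> y = ?\<sigma> y \<cdot> \<tau>" if "unifies \<tau> ((Var x, t) # E)" for \<tau> y
  proof -
    have \<tau>: "(\<lambda>y. ?e y \<cdot> \<tau>) = \<tau>" "unifies \<tau> E"
      using that by (auto simp: unifies_def sbst_upd_absorb)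
    then have "unifies \<tau> (sbst_eqs E ?e)" by (simp only: unifies_sbst_eqs)
    then have "\<sigma> z \<cdot> \<tau> = \<tau> z" for z using assms(3) unfolding imgu_def by metis
    then have "?\<sigma> y \<cdot> \<tau> = ?e y \<cdot> \<tau>" by (simp add: sbst_sbst)
    also have "\<dots> = \<tau> y" using \<tau>(1) by metis
    finally show ?thesis by simp
  qed
  ultimately show ?thesis by (simp add: imgu_def)
qed

lemma imgu_exists:
  assumes "unifies \<tau> E" "\<forall>(s, t)\<in>set E. wf_trm F s \<and> wf_trm F t"
  shows "\<exists>\<sigma>. imgu F \<sigma> E"
  using assms
proof (induction E arbitrary: \<tau> rule: wf_induct_rule[OF wf_measures[of
    "[\<lambda>E. card (vars_eqs E), \<lambda>E. \<Sum>(s, t)\<leftarrow>E. Suc (size s)]"]])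
  case (1 E)
  have elim: "\<exists>\<sigma>. imgu F \<sigma> ((Var x, t) # E')"
    if E: "set E = insert e (set E')" "e = (Var x, t) \<or> e = (t, Var x)" and xt: "t \<noteq> Var x"
    for x t e E'
  proof -
    have \<tau>: "\<tau> x = t \<cdot> \<tau>" "unifies \<tau> E'" using E 1(2) by (auto simp: unifies_def)
    have x: "x \<notin> vars t" using size_sbst_var[of x t \<tau>] xt \<tau>(1) by auto
    have wf: "wf_trm F t" using E 1(3) by auto
    let ?e = "Var(x := t)" let ?E = "sbst_eqs E' ?e"
    have "vars_eqs ?E \<subseteq> (vars_eqs E' \<union> vars t) - {x}"
      using x by (auto simp: vars_eqs_def sbst_eqs_def vars_sbst split: if_splits)
    moreover have "vars_eqs E = insert x (vars t \<union> vars_eqs E')"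
      using E by (auto simp: vars_eqs_def)
    ultimately have "vars_eqs ?E \<subset> vars_eqs E" by blast
    then have "(?E, E) \<in> measures [\<lambda>E. card (vars_eqs E), \<lambda>E. \<Sum>(s, t)\<leftarrow>E. Suc (size s)]"
      by (simp add: psubset_card_mono)
    moreover have "unifies \<tau> ?E"
      using \<tau>(2) by (simp only: unifies_sbst_eqs sbst_upd_absorb[where \<tau> = \<tau>, OF \<tau>(1)])
    moreover have "\<forall>(s, t)\<in>set ?E. wf_trm F s \<and> wf_trm F t"
      using 1(3) wf E(1) by (auto simp: sbst_eqs_def wf_trm_sbst_iff)
    ultimately obtain \<sigma> where "imgu F \<sigma> ?E" using 1(1) by blast
    then show ?thesis using imgu_elim[OF x wf] by blast
  qed
  have smaller: "\<exists>\<sigma>. imgu F \<sigma> E'"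
    if "vars_eqs E' \<subseteq> vars_eqs E" "(\<Sum>(s, t)\<leftarrow>E'. Suc (size s)) < (\<Sum>(s, t)\<leftarrow>E. Suc (size s))"
      "unifies \<tau> E'" "\<forall>(s, t)\<in>set E'. wf_trm F s \<and> wf_trm F t" for E'
    using that 1(1)[of E' \<tau>] card_mono[OF finite_vars_eqs that(1)]
    by (auto simp: order_le_less)
  show ?case
  proof (cases E)
    case Nil
    then have "imgu F Var E" using is_sbst_Var by (auto simp: imgu_def unifies_def)
    then show ?thesis by blast
  next
    case (Cons e E')
    obtain s t where e: "e = (s, t)" by (cases e)
    consider (triv) x where "s = Var x" "t = Var x"
      | (l) x where "s = Var x" "t \<noteq> Var x" | (r) x where "t = Var x" "s \<noteq> Var x"
      | (Fun) f ss g ts where "s = Fun f ss" "t = Fun g ts"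
      by (cases s; cases t) auto
    then show ?thesis
    proof cases
      case triv
      then obtain \<sigma> where "imgu F \<sigma> E'"
        using smaller[of E'] 1(2,3) Cons e by (auto simp: unifies_def vars_eqs_def)
      then show ?thesis using Cons e triv by (auto simp: imgu_def unifies_def)
    next
      case l
      then show ?thesis using elim[of e E' x t] Cons e by auto
    next
      case r
      then obtain \<sigma> where "imgu F \<sigma> ((Var x, s) # E')" using elim[of e E' x s] Cons e by auto
      moreover have "unifies \<rho> ((Var x, s) # E') \<longleftrightarrow> unifies \<rho> E" for \<rho>
        using Cons e r by (auto simp: unifies_def)
      ultimately show ?thesis by (auto simp: imgu_def)
    next
      case Fun
      have "s \<cdot> \<tau> = t \<cdot> \<tau>" using 1(2) Cons e by (auto simp: unifies_def)
      then have fg: "f = g" and m: "map (\<lambda>t. t \<cdot> \<tau>) ss = map (\<lambda>t. t \<cdot> \<tau>) ts" using Fun by auto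
      have len: "length ss = length ts" using m by (metis length_map)
      have zip: "unifies \<rho> (zip ss ts @ E') \<longleftrightarrow> unifies \<rho> E" for \<rho>
        using len fg by (auto simp: unifies_def Cons e Fun list_eq_iff_nth_eq set_zip)
      have "(\<Sum>(s, t)\<leftarrow>zip ss ts. Suc (size s)) = size_list size ss"
        using len by (induction ss ts rule: list_induct2) auto
      moreover have "vars_eqs (zip ss ts @ E') \<subseteq> vars_eqs E"
        by (auto simp: vars_eqs_def Cons e Fun dest: set_zip_leftD set_zip_rightD)
      moreover have "\<forall>(s, t)\<in>set (zip ss ts @ E'). wf_trm F s \<and> wf_trm F t"
        using 1(3) by (auto simp: Cons e Fun list_all_iff dest: set_zip_leftD set_zip_rightD)
      ultimately obtain \<sigma> where "imgu F \<sigma> (zip ss ts @ E')"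
        using smaller[of "zip ss ts @ E'"] 1(2) zip by (auto simp: Cons e Fun)
      then show ?thesis using zip by (auto simp: imgu_def)
    qed
  qed
qed

lemma mgu_exists:
  assumes "wf_trm F s" "wf_trm F t" "s \<cdot> \<tau> = t \<cdot> \<tau>"
  shows "\<exists>\<sigma>. is_mgu F \<sigma> s t"
proof -
  have "unifies \<tau> [(s, t)]" using assms by (simp add: unifies_def)
  then obtain \<sigma> where "imgu F \<sigma> [(s, t)]" using imgu_exists[of \<tau> "[(s, t)]" F] assms by auto
  then show ?thesis by (auto simp: imgu_def unifies_def is_mgu_def)
qed

subsection \<open>Rewrite steps\<close>

lemma wf_trm_update: "wf_trm F (Fun f ts) \<Longrightarrow> wf_trm F u \<Longrightarrow> wf_trm F (Fun f (ts[i := u]))"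
  using set_update_subset_insert[of ts i u] by (auto simp: list_all_iff)

lemma rstep_Un: "rstep F (R \<union> Q) = rstep F R \<union> rstep F Q"
  unfolding rstep_def by blast

lemma rstep_mono: "R \<subseteq> Q \<Longrightarrow> rstep F R \<subseteq> rstep F Q"
  unfolding rstep_def by blast

lemma rstepI:
  assumes "wf_trm F s" "(l, r) \<in> R" "p \<in> poss s" "is_sbst F \<sigma>" "subt_at s p = l \<cdot> \<sigma>"
    and "t = replace_at s p (r \<cdot> \<sigma>)"
  shows "(s, t) \<in> rstep F R"
  using assms unfolding rstep_def by blast

lemma rstepE:
  assumes "(s, t) \<in> rstep F R"
  obtains l r p \<sigma> where "wf_trm F s" "(l, r) \<in> R" "p \<in> poss s" "is_sbst F \<sigma>"
    "subt_at s p = l \<cdot> \<sigma>" "t = replace_at s p (r \<cdot> \<sigma>)"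
  using assms unfolding rstep_def by blast

lemma rstep_wf_left: "(s, t) \<in> rstep F R \<Longrightarrow> wf_trm F s"
  unfolding rstep_def by blast

lemma rstep_root:
  "(l, r) \<in> R \<Longrightarrow> is_sbst F \<sigma> \<Longrightarrow> wf_trm F (l \<cdot> \<sigma>) \<Longrightarrow> (l \<cdot> \<sigma>, r \<cdot> \<sigma>) \<in> rstep F R"
  by (rule rstepI[where p = "[]"]) simp_all

lemma rstep_arg:
  assumes "(ts ! i, u) \<in> rstep F R" "i < length ts" "wf_trm F (Fun f ts)"
  shows "(Fun f ts, Fun f (ts[i := u])) \<in> rstep F R"
proof -
  obtain l r p \<sigma> where "(l, r) \<in> R" "p \<in> poss (ts ! i)" "is_sbst F \<sigma>"
    "subt_at (ts ! i) p = l \<cdot> \<sigma>" "u = replace_at (ts ! i) p (r \<cdot> \<sigma>)"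
    using assms(1) by (rule rstepE)
  with assms(2,3) show ?thesis by (intro rstepI[where p = "i # p"]) auto
qed

lemma rstep_cases:
  assumes "(s, t) \<in> rstep F R"
  obtains (root) l r \<sigma> where "(l, r) \<in> R" "is_sbst F \<sigma>" "wf_trm F (l \<cdot> \<sigma>)" "s = l \<cdot> \<sigma>" "t = r \<cdot> \<sigma>"
  | (arg) f ts i u where "s = Fun f ts" "i < length ts" "(ts ! i, u) \<in> rstep F R"
      "wf_trm F (Fun f ts)" "t = Fun f (ts[i := u])"
proof -
  obtain l r p \<sigma> where *: "wf_trm F s" "(l, r) \<in> R" "p \<in> poss s" "is_sbst F \<sigma>"
    "subt_at s p = l \<cdot> \<sigma>" "t = replace_at s p (r \<cdot> \<sigma>)"
    using assms by (rule rstepE)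
  show ?thesis
  proof (cases p)
    case Nil
    then show ?thesis using * by (intro root) auto
  next
    case (Cons i q)
    then obtain f ts where s: "s = Fun f ts" using *(3) by (cases s) auto
    then have i: "i < length ts" "q \<in> poss (ts ! i)" "subt_at (ts ! i) q = l \<cdot> \<sigma>"
      using *(3,5) Cons by auto
    have "wf_trm F (ts ! i)" using *(1) s i(1) by (simp add: list_all_length)
    then have "(ts ! i, replace_at (ts ! i) q (r \<cdot> \<sigma>)) \<in> rstep F R"
      using *(2,4) i(2,3) by (intro rstepI) auto
    then show ?thesis using *(1,6) s i(1) Cons by (intro arg) auto
  qed
qed

definition wf_rules :: "('f \<rightharpoonup> nat) \<Rightarrow> ('f, 'v) rule set \<Rightarrow> bool" where
  "wf_rules F R \<longleftrightarrow> (\<forall>(l, r)\<in>R. wf_trm F l \<and> wf_trm F r)"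

lemma rstep_wf_right:
  assumes "wf_rules F R" "(s, t) \<in> rstep F R"
  shows "wf_trm F t"
proof -
  obtain l r p \<sigma> where *: "wf_trm F s" "(l, r) \<in> R" "p \<in> poss s" "is_sbst F \<sigma>"
    "subt_at s p = l \<cdot> \<sigma>" "t = replace_at s p (r \<cdot> \<sigma>)"
    using assms(2) by (rule rstepE)
  then show ?thesis using assms(1)
    by (auto simp: wf_rules_def intro!: wf_trm_replace_at wf_trm_is_sbst)
qed

lemma rsteps_wf_right:
  "wf_rules F R \<Longrightarrow> (s, t) \<in> (rstep F R)\<^sup>* \<Longrightarrow> wf_trm F s \<Longrightarrow> wf_trm F t"
  by (erule rtranclE) (auto intro: rstep_wf_right)

lemma poss_replace_at: "p \<in> poss t \<Longrightarrow> p \<in> poss (replace_at t p s) \<and> subt_at (replace_at t p s) p = s"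
  by (induction t p rule: subt_at.induct) force+

lemma replace_at_replace_at: "p \<in> poss t \<Longrightarrow> replace_at (replace_at t p s) p u = replace_at t p u"
  by (induction t p rule: subt_at.induct) auto

lemma rstep_ctxt:
  "(s, t) \<in> rstep F R \<Longrightarrow> p \<in> poss u \<Longrightarrow> wf_trm F u \<Longrightarrow>
    (replace_at u p s, replace_at u p t) \<in> rstep F R"
proof (induction u p rule: subt_at.induct)
  case (2 f ts i p)
  then have i: "i < length ts" "p \<in> poss (ts ! i)" "wf_trm F (ts ! i)"
    by (auto simp: list_all_length)
  with 2 have step: "(replace_at (ts ! i) p s, replace_at (ts ! i) p t) \<in> rstep F R" by blast
  have "wf_trm F (Fun f (ts[i := replace_at (ts ! i) p s]))"
    using rstep_wf_left[OF step] 2(4) by (intro wf_trm_update)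
  then show ?case
    using rstep_arg[of "ts[i := replace_at (ts ! i) p s]" i "replace_at (ts ! i) p t" F R f] step i(1)
    by simp
qed auto

lemma rstep_sbst:
  assumes "(s, t) \<in> rstep F R" "is_sbst F \<gamma>"
  shows "(s \<cdot> \<gamma>, t \<cdot> \<gamma>) \<in> rstep F R"
proof -
  obtain l r p \<sigma> where *: "wf_trm F s" "(l, r) \<in> R" "p \<in> poss s" "is_sbst F \<sigma>"
    "subt_at s p = l \<cdot> \<sigma>" "t = replace_at s p (r \<cdot> \<sigma>)"
    using assms(1) by (rule rstepE)
  then have "p \<in> poss (s \<cdot> \<gamma>)" "subt_at (s \<cdot> \<gamma>) p = l \<cdot> (\<lambda>x. \<sigma> x \<cdot> \<gamma>)"
    using poss_sbst[of p s \<gamma>] by (auto simp only: sbst_sbst)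
  moreover have "t \<cdot> \<gamma> = replace_at (s \<cdot> \<gamma>) p (r \<cdot> (\<lambda>x. \<sigma> x \<cdot> \<gamma>))"
    using * by (simp only: replace_at_sbst sbst_sbst)
  ultimately show ?thesis
    using is_sbst_comp[OF *(4) assms(2)] wf_trm_is_sbst[OF assms(2) *(1)] *(2) by (intro rstepI)
qed

lemma rstep_converse:
  assumes "wf_rules F R" "(s, t) \<in> rstep F R"
  shows "(t, s) \<in> rstep F (R\<inverse>)"
proof -
  obtain l r p \<sigma> where *: "wf_trm F s" "(l, r) \<in> R" "p \<in> poss s" "is_sbst F \<sigma>"
    "subt_at s p = l \<cdot> \<sigma>" "t = replace_at s p (r \<cdot> \<sigma>)"
    using assms(2) by (rule rstepE)
  have "s = replace_at t p (l \<cdot> \<sigma>)"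
    using * by (metis replace_at_replace_at replace_at_subt_at)
  then show ?thesis
    using * poss_replace_at[OF *(3), of "r \<cdot> \<sigma>"] rstep_wf_right[OF assms]
    by (intro rstepI[of F t r l "R\<inverse>" p \<sigma> s]) auto
qed

lemma rsteps_arg:
  assumes "(ts ! i, u) \<in> (rstep F R)\<^sup>*" "i < length ts" "wf_trm F (Fun f ts)" "wf_rules F R"
  shows "(Fun f ts, Fun f (ts[i := u])) \<in> (rstep F R)\<^sup>*"
  using assms(1)
proof (induction rule: rtrancl_induct)
  case (step y z)
  have "wf_trm F (Fun f (ts[i := y]))"
    using assms(3) rstep_wf_left[OF step(2)] by (intro wf_trm_update)
  from rstep_arg[of "ts[i := y]" i z F R f, OF _ _ this] step assms(2)
  have "(Fun f (ts[i := y]), Fun f (ts[i := z])) \<in> rstep F R" by simp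
  with step(3) show ?case by (rule rtrancl_into_rtrancl)
qed simp

lemma rsteps_args:
  assumes len: "length us = length ts"
    and steps: "\<And>i. i < length ts \<Longrightarrow> (ts ! i, us ! i) \<in> (rstep F R)\<^sup>*"
    and wf: "wf_trm F (Fun f ts)" "wf_rules F R"
  shows "(Fun f ts, Fun f us) \<in> (rstep F R)\<^sup>*"
proof -
  have "(Fun f ts, Fun f (take k us @ drop k ts)) \<in> (rstep F R)\<^sup>*" if "k \<le> length ts" for k
    using that
  proof (induction k)
    case (Suc k)
    let ?xs = "take k us @ drop k ts"
    have IH: "(Fun f ts, Fun f ?xs) \<in> (rstep F R)\<^sup>*" using Suc by simp
    have k: "k < length ts" using Suc by simp
    have "?xs ! k = ts ! k" using k len by (simp add: nth_append)
    then have "(Fun f ?xs, Fun f (?xs[k := us ! k])) \<in> (rstep F R)\<^sup>*"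
      using steps[OF k] k len rsteps_wf_right[OF wf(2) IH wf(1)] wf(2) by (intro rsteps_arg) auto
    moreover have "?xs[k := us ! k] = take (Suc k) us @ drop (Suc k) ts"
      using k len by (simp add: list_update_append take_Suc_conv_app_nth Cons_nth_drop_Suc[symmetric])
    ultimately show ?case using IH by simp
  qed simp
  from this[of "length ts"] show ?thesis using len by simp
qed

lemma rsteps_sbst:
  assumes "\<And>x. (\<sigma> x, \<tau> x) \<in> (rstep F R)\<^sup>*" "wf_rules F R"
  shows "wf_trm F (t \<cdot> \<sigma>) \<Longrightarrow> (t \<cdot> \<sigma>, t \<cdot> \<tau>) \<in> (rstep F R)\<^sup>*"
proof (induction t)
  case (Fun f ts)
  then have "(ts ! i \<cdot> \<sigma>, ts ! i \<cdot> \<tau>) \<in> (rstep F R)\<^sup>*" if "i < length ts" for i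
    using that by (auto simp: list_all_length)
  then show ?case using Fun(2) assms(2)
    unfolding sbst_apply.simps by (intro rsteps_args) auto
qed (use assms in auto)

lemma rsteps_replace_at:
  assumes u: "(\<sigma> x, u) \<in> (rstep F R)\<^sup>*" and R: "wf_rules F R" and \<tau>: "\<tau> = \<sigma>(x := u)"
  shows "p \<in> poss t \<Longrightarrow> subt_at t p = Var x \<Longrightarrow> wf_trm F (t \<cdot> \<sigma>) \<Longrightarrow>
    (replace_at (t \<cdot> \<sigma>) p u, t \<cdot> \<tau>) \<in> (rstep F R)\<^sup>*"
proof (induction p arbitrary: t)
  case Nil
  then show ?case using \<tau> by simp
next
  case (Cons i p)
  then obtain f ts where t: "t = Fun f ts" by (cases t) auto
  then have i: "i < length ts" "p \<in> poss (ts ! i)" "subt_at (ts ! i) p = Var x"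
    and wf: "\<And>j. j < length ts \<Longrightarrow> wf_trm F (ts ! j \<cdot> \<sigma>)"
    using Cons.prems by (auto simp: list_all_length)
  let ?ss = "map (\<lambda>t. t \<cdot> \<sigma>) ts"
  have "x \<in> vars (ts ! i)" unfolding vars_iff_poss by (rule bexI[of _ p]) (fact i)+
  then have wfu: "wf_trm F u" using wf[OF i(1)] rsteps_wf_right[OF R u] by (auto simp: wf_trm_sbst_iff)
  have "(\<sigma> y, \<tau> y) \<in> (rstep F R)\<^sup>*" for y using u \<tau> by simp
  note args = rsteps_sbst[OF this R wf]
  have "(?ss[i := replace_at (ts ! i \<cdot> \<sigma>) p u] ! j, map (\<lambda>t. t \<cdot> \<tau>) ts ! j) \<in> (rstep F R)\<^sup>*"
    if "j < length ts" for j
    using that i(1) Cons.IH[OF i(2,3) wf[OF i(1)]] args[OF that] by (cases "j = i") simp_all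
  moreover have "wf_trm F (replace_at (ts ! i \<cdot> \<sigma>) p u)"
    using wf_trm_replace_at[OF _ wf[OF i(1)] wfu] poss_sbst[OF i(2)] by blast
  then have "wf_trm F (Fun f (?ss[i := replace_at (ts ! i \<cdot> \<sigma>) p u]))"
    using Cons.prems(3) t by (intro wf_trm_update) simp_all
  ultimately have "(Fun f (?ss[i := replace_at (ts ! i \<cdot> \<sigma>) p u]), Fun f (map (\<lambda>t. t \<cdot> \<tau>) ts))
      \<in> (rstep F R)\<^sup>*"
    using R by (intro rsteps_args) auto
  then show ?case using i(1) by (simp add: t)
qed

subsection \<open>Overlaps\<close>

lemma critical_peak:
  fixes R Q :: "('f, 'v) rule set"
  assumes inf: "infinite (UNIV :: 'v set)"
    and R: "(l1, r1) \<in> R" "wf_trm F l1" and Q: "(l2, r2) \<in> Q" "wf_trm F l2"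
    and vars: "vars r1 \<subseteq> vars l1 \<or> vars r2 \<subseteq> vars l2"
    and sb: "is_sbst F \<tau>" "is_sbst F \<sigma>"
    and p: "p \<in> poss l2" "\<And>x. subt_at l2 p \<noteq> Var x"
    and eq: "l1 \<cdot> \<tau> = subt_at l2 p \<cdot> \<sigma>"
  shows "replace_at (l2 \<cdot> \<sigma>) p (r1 \<cdot> \<tau>) = r2 \<cdot> \<sigma> \<or>
    (\<exists>u v \<gamma>. (u, v) \<in> CP F R Q \<and> is_sbst F \<gamma> \<and>
      replace_at (l2 \<cdot> \<sigma>) p (r1 \<cdot> \<tau>) = u \<cdot> \<gamma> \<and> r2 \<cdot> \<sigma> = v \<cdot> \<gamma>)"
proof -
  define V1 where "V1 = vars l1 \<union> vars r1"
  define V2 where "V2 = vars l2 \<union> vars r2"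
  have fin: "finite V1" "finite V2" by (simp_all add: V1_def V2_def)
  have "infinite (UNIV - V2)" using inf fin by simp
  then obtain B where B: "finite B" "card B = card V1" "B \<subseteq> UNIV - V2"
    using infinite_arbitrarily_large by metis
  then obtain \<pi> where \<pi>: "bij_betw \<pi> V1 B" using finite_same_card_bij[OF fin(1)] by metis
  have inj: "inj_on \<pi> V1" and im: "\<pi> ` V1 \<inter> V2 = {}" using \<pi> B by (auto simp: bij_betw_def)
  define \<theta> where
    "\<theta> y = (if y \<in> V2 then \<sigma> y else if y \<in> \<pi> ` V1 then \<tau> (the_inv_into V1 \<pi> y) else Var y)" for y
  have "{y. \<theta> y \<noteq> Var y} \<subseteq> V2 \<union> \<pi> ` V1" by (auto simp: \<theta>_def)
  from finite_subset[OF this] have \<theta>: "is_sbst F \<theta>"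
    using fin sb by (auto simp: is_sbst_def \<theta>_def)
  have \<theta>1: "\<theta> (\<pi> x) = \<tau> x" if "x \<in> V1" for x
    using that im inj by (auto simp: \<theta>_def the_inv_into_f_f)
  have \<theta>2: "\<theta> x = \<sigma> x" if "x \<in> V2" for x using that by (simp add: \<theta>_def)
  define l1' where "l1' = map_trm id \<pi> l1"
  define r1' where "r1' = map_trm id \<pi> r1"
  have l1': "l1' \<cdot> \<theta> = l1 \<cdot> \<tau>" and r1': "r1' \<cdot> \<theta> = r1 \<cdot> \<tau>"
    unfolding l1'_def r1'_def map_trm_sbst sbst_sbst
    by (auto intro!: sbst_cong \<theta>1 simp: V1_def)
  have l2: "l2 \<cdot> \<theta> = l2 \<cdot> \<sigma>" and r2: "r2 \<cdot> \<theta> = r2 \<cdot> \<sigma>"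
    by (auto intro!: sbst_cong \<theta>2 simp: V2_def)
  have "subt_at l2 p \<cdot> \<theta> = subt_at l2 p \<cdot> \<sigma>"
    using poss_sbst[OF p(1)] l2 by metis
  then have unif: "l1' \<cdot> \<theta> = subt_at l2 p \<cdot> \<theta>" using l1' eq by simp
  have var1: "variant (l1, r1) (l1', r1')"
    using inj by (auto simp: l1'_def r1'_def V1_def)
  have var2: "variant (l2, r2) (l2, r2)"
    by (auto intro!: exI[of _ id] simp: trm.map_id)
  have disj: "(vars l1' \<union> vars r1') \<inter> (vars l2 \<union> vars r2) = {}"
    using im by (auto simp: l1'_def r1'_def trm.set_map V1_def V2_def)
  have "wf_trm F l1'" using R(2) by (simp add: l1'_def map_trm_sbst wf_trm_sbst_iff)
  then obtain \<mu> where \<mu>: "is_mgu F \<mu> l1' (subt_at l2 p)"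
    using mgu_exists[OF _ wf_trm_subt_at[OF p(1) Q(2)] unif] by blast
  then obtain \<gamma> where \<gamma>: "is_sbst F \<gamma>" "\<And>x. \<theta> x = \<mu> x \<cdot> \<gamma>"
    using \<theta> unif unfolding is_mgu_def by blast
  have fact: "t \<cdot> \<theta> = t \<cdot> \<mu> \<cdot> \<gamma>" for t
    unfolding sbst_sbst using \<gamma>(2) by (auto intro: sbst_cong)
  have left: "replace_at (l2 \<cdot> \<sigma>) p (r1 \<cdot> \<tau>) = replace_at l2 p r1' \<cdot> \<mu> \<cdot> \<gamma>"
    using replace_at_sbst[OF p(1), of r1' \<theta>] l2 r1' fact by metis
  have right: "r2 \<cdot> \<sigma> = r2 \<cdot> \<mu> \<cdot> \<gamma>" using r2 fact by metis
  show ?thesis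
  proof (cases "p = [] \<and> variant (l1', r1') (l2, r2)")
    case True
    then obtain \<rho> where \<rho>: "inj_on \<rho> (vars l1' \<union> vars r1')"
      "l2 = map_trm id \<rho> l1'" "r2 = map_trm id \<rho> r1'" by auto
    have sub: "vars r1' \<subseteq> vars l1'"
    proof (cases "vars r1 \<subseteq> vars l1")
      case True
      then show ?thesis by (auto simp: l1'_def r1'_def trm.set_map)
    next
      case False
      then have "\<rho> ` vars r1' \<subseteq> \<rho> ` vars l1'" using vars \<rho>(2,3) by (simp add: trm.set_map)
      then show ?thesis using \<rho>(1) by (auto simp: inj_on_def)
    qed
    have "l1' \<cdot> \<theta> = l1' \<cdot> (\<lambda>x. \<theta> (\<rho> x))"
      using unif True \<rho>(2) by (simp add: map_trm_sbst sbst_sbst)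
    then have "r1' \<cdot> \<theta> = r1' \<cdot> (\<lambda>x. \<theta> (\<rho> x))" using sub by (auto simp: sbst_cong_iff)
    also have "\<dots> = r2 \<cdot> \<theta>" using \<rho>(3) by (simp add: map_trm_sbst sbst_sbst)
    finally show ?thesis using True r1' r2 by simp
  next
    case False
    then have "(replace_at l2 p r1' \<cdot> \<mu>, r2 \<cdot> \<mu>) \<in> CP F R Q"
      unfolding CP_def using R(1) Q(1) var1 var2 disj p \<mu> by blast
    then show ?thesis using left right \<gamma>(1) by blast
  qed
qed

lemma root_peak_cases:
  fixes R Q :: "('f, 'v) rule set"
  assumes inf: "infinite (UNIV :: 'v set)"
    and wf: "wf_rules F R" "wf_rules F Q"
    and vars: "(\<forall>(l, r)\<in>R. vars r \<subseteq> vars l) \<or> (\<forall>(l, r)\<in>Q. vars r \<subseteq> vars l)"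
    and lr: "(l, r) \<in> R" "is_sbst F \<sigma>" "wf_trm F (l \<cdot> \<sigma>)"
    and b: "(l \<cdot> \<sigma>, b) \<in> rstep F Q"
  obtains (trivial) "b = r \<cdot> \<sigma>"
  | (critical) u v \<gamma> where "(u, v) \<in> CP F Q R" "is_sbst F \<gamma>" "b = u \<cdot> \<gamma>" "r \<cdot> \<sigma> = v \<cdot> \<gamma>"
  | (variable) p x u where "p \<in> poss l" "subt_at l p = Var x" "(\<sigma> x, u) \<in> rstep F Q"
      "b = replace_at (l \<cdot> \<sigma>) p u"
proof -
  obtain l' r' q \<tau> where *: "(l', r') \<in> Q" "q \<in> poss (l \<cdot> \<sigma>)" "is_sbst F \<tau>"
    "subt_at (l \<cdot> \<sigma>) q = l' \<cdot> \<tau>" "b = replace_at (l \<cdot> \<sigma>) q (r' \<cdot> \<tau>)"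
    using b by (rule rstepE)
  from *(2) show ?thesis
  proof (cases rule: poss_sbst_cases)
    case 1
    have "wf_trm F l'" "wf_trm F l" "vars r' \<subseteq> vars l' \<or> vars r \<subseteq> vars l"
      using *(1) lr(1) wf vars by (auto simp: wf_rules_def)
    moreover have "l' \<cdot> \<tau> = subt_at l q \<cdot> \<sigma>" using poss_sbst[OF 1(1), of \<sigma>] *(4) by simp
    ultimately show ?thesis
      using critical_peak[OF inf *(1) _ lr(1) _ _ *(3) lr(2) 1] *(5) trivial critical by metis
  next
    case (2 q1 q2 x)
    have \<sigma>x: "subt_at (l \<cdot> \<sigma>) q1 = \<sigma> x" "q1 \<in> poss (l \<cdot> \<sigma>)"
      using poss_sbst[OF 2(2), of \<sigma>] 2(3) by simp_all
    have "x \<in> vars l" unfolding vars_iff_poss using 2(2,3) by blast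
    then have "wf_trm F (\<sigma> x)" using lr(3) by (simp add: wf_trm_sbst_iff)
    moreover have "subt_at (\<sigma> x) q2 = l' \<cdot> \<tau>"
      using subt_at_append[OF \<sigma>x(2), of q2] \<sigma>x(1) *(4) 2(1) by simp
    ultimately have "(\<sigma> x, replace_at (\<sigma> x) q2 (r' \<cdot> \<tau>)) \<in> rstep F Q"
      using * 2(4) by (intro rstepI) auto
    moreover have "b = replace_at (l \<cdot> \<sigma>) q1 (replace_at (\<sigma> x) q2 (r' \<cdot> \<tau>))"
      using replace_at_append[OF \<sigma>x(2), of q2] \<sigma>x(1) *(5) 2(1) by simp
    ultimately show ?thesis using variable 2(2,3) by blast
  qed
qed

lemma peak_cases:
  assumes "(c, a) \<in> rstep F R" "(c, b) \<in> rstep F Q"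
    and rootR: "\<And>l r \<sigma> b. (l, r) \<in> R \<Longrightarrow> is_sbst F \<sigma> \<Longrightarrow> wf_trm F (l \<cdot> \<sigma>) \<Longrightarrow>
      (l \<cdot> \<sigma>, b) \<in> rstep F Q \<Longrightarrow> J (r \<cdot> \<sigma>) b"
    and rootQ: "\<And>l r \<sigma> a. (l, r) \<in> Q \<Longrightarrow> is_sbst F \<sigma> \<Longrightarrow> wf_trm F (l \<cdot> \<sigma>) \<Longrightarrow>
      (l \<cdot> \<sigma>, a) \<in> rstep F R \<Longrightarrow> J a (r \<cdot> \<sigma>)"
    and par: "\<And>a b d. (a, d) \<in> rstep F Q \<Longrightarrow> (b, d) \<in> rstep F R \<Longrightarrow> J a b"
    and ctxt: "\<And>f ts i a b. i < length ts \<Longrightarrow> wf_trm F (Fun f ts) \<Longrightarrow> J a b \<Longrightarrow>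
      J (Fun f (ts[i := a])) (Fun f (ts[i := b]))"
    and wf: "wf_rules F R" "wf_rules F Q"
  shows "J a b"
  using assms(1,2)
proof (induction c arbitrary: a b)
  case (Var x)
  from Var(1) show ?case
  proof (cases rule: rstep_cases)
    case root
    then show ?thesis using rootR Var(2) by metis
  qed auto
next
  case (Fun f ts)
  from Fun(2) show ?case
  proof (cases rule: rstep_cases)
    case root
    then show ?thesis using rootR Fun(3) by metis
  next
    case (arg f' ts' i u)
    then have i: "i < length ts" "(ts ! i, u) \<in> rstep F R" "wf_trm F (Fun f ts)" "a = Fun f (ts[i := u])"
      by auto
    from Fun(3) show ?thesis
    proof (cases rule: rstep_cases)
      case root
      then show ?thesis using rootQ Fun(2) by metis
    next
      case (arg f' ts' j v)
      then have j: "j < length ts" "(ts ! j, v) \<in> rstep F Q" "b = Fun f (ts[j := v])" by auto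
      show ?thesis
      proof (cases "i = j")
        case True
        then have "J u v" using Fun.IH[of "ts ! i" u v] i j by auto
        then show ?thesis using ctxt i j True by simp
      next
        case False
        have wfu: "wf_trm F (Fun f (ts[i := u]))" "wf_trm F (Fun f (ts[j := v]))"
          using i(3) rstep_wf_right[OF wf(1) i(2)] rstep_wf_right[OF wf(2) j(2)]
          by (simp_all only: wf_trm_update)
        have "(Fun f (ts[i := u]), Fun f (ts[i := u, j := v])) \<in> rstep F Q"
          using j i False wfu by (intro rstep_arg) auto
        moreover have "(Fun f (ts[j := v]), Fun f (ts[j := v, i := u])) \<in> rstep F R"
          using j i False wfu by (intro rstep_arg) auto
        ultimately show ?thesis
          using par list_update_swap[OF False, of ts u v] i(4) j(3) by metis
      qed
    qed
  qed
qed

lemma variable_peak: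
  assumes R: "wf_rules F R" and Q: "wf_rules F Q"
    and lr: "(l, r) \<in> R" "is_sbst F \<sigma>" "wf_trm F (l \<cdot> \<sigma>)"
    and p: "p \<in> poss l" "subt_at l p = Var x" and u: "(\<sigma> x, u) \<in> rstep F Q"
  obtains \<tau> where
    "(replace_at (l \<cdot> \<sigma>) p u, l \<cdot> \<tau>) \<in> (rstep F Q)\<^sup>*" "(l \<cdot> \<tau>, r \<cdot> \<tau>) \<in> rstep F R"
    "linear_trm l \<Longrightarrow> replace_at (l \<cdot> \<sigma>) p u = l \<cdot> \<tau>"
    "linear_trm r \<Longrightarrow> (r \<cdot> \<sigma>, r \<cdot> \<tau>) \<in> (rstep F Q)\<^sup>="
    "r \<cdot> \<sigma> = r \<cdot> \<tau> \<or> (r \<cdot> \<sigma>, r \<cdot> \<tau>) \<in> rstep F Q O (rstep F Q)\<^sup>*"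
proof -
  define \<tau> where "\<tau> = \<sigma>(x := u)"
  have wfu: "wf_trm F u" using rstep_wf_right[OF Q u] .
  have \<tau>: "is_sbst F \<tau>" using is_sbst_upd[OF lr(2) wfu] by (simp add: \<tau>_def)
  have u': "(\<sigma> x, u) \<in> (rstep F Q)\<^sup>*" using u by simp
  have wflr: "wf_trm F l" "wf_trm F r" using R lr(1) by (auto simp: wf_rules_def)
  have r: "r \<cdot> \<sigma> = r \<cdot> \<tau> \<or> (\<exists>m. (r \<cdot> \<sigma>, m) \<in> rstep F Q \<and> (m, r \<cdot> \<tau>) \<in> (rstep F Q)\<^sup>* \<and>
    (linear_trm r \<longrightarrow> m = r \<cdot> \<tau>))"
  proof (cases "x \<in> vars r")
    case True
    then obtain q where q: "q \<in> poss r" "subt_at r q = Var x" unfolding vars_iff_poss by blast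
    then have q': "q \<in> poss (r \<cdot> \<sigma>)" "subt_at (r \<cdot> \<sigma>) q = \<sigma> x" using poss_sbst[of q r \<sigma>] by auto
    have wf: "wf_trm F (r \<cdot> \<sigma>)" using wf_trm_is_sbst lr(2) wflr(2) .
    have "(r \<cdot> \<sigma>, replace_at (r \<cdot> \<sigma>) q u) \<in> rstep F Q"
      using rstep_ctxt[OF u q'(1) wf] replace_at_subt_at[OF q'(1)] q'(2) by simp
    then show ?thesis
      using rsteps_replace_at[OF u' Q \<tau>_def q wf] replace_at_linear[OF _ q \<tau>_def] by blast
  next
    case False
    then have "r \<cdot> \<sigma> = r \<cdot> \<tau>" by (intro sbst_cong) (auto simp: \<tau>_def)
    then show ?thesis ..
  qed
  show ?thesis
  proof (rule that)
    show "(replace_at (l \<cdot> \<sigma>) p u, l \<cdot> \<tau>) \<in> (rstep F Q)\<^sup>*"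
      using rsteps_replace_at[OF u' Q \<tau>_def p lr(3)] .
    show "(l \<cdot> \<tau>, r \<cdot> \<tau>) \<in> rstep F R" using rstep_root[OF lr(1) \<tau>] wf_trm_is_sbst[OF \<tau> wflr(1)] .
    show "linear_trm l \<Longrightarrow> replace_at (l \<cdot> \<sigma>) p u = l \<cdot> \<tau>" using replace_at_linear[OF _ p \<tau>_def] .
    show "linear_trm r \<Longrightarrow> (r \<cdot> \<sigma>, r \<cdot> \<tau>) \<in> (rstep F Q)\<^sup>=" using r by auto
    show "r \<cdot> \<sigma> = r \<cdot> \<tau> \<or> (r \<cdot> \<sigma>, r \<cdot> \<tau>) \<in> rstep F Q O (rstep F Q)\<^sup>*" using r by blast
  qed
qed

subsection \<open>Local peaks\<close>

text \<open>In a peak \<open>a\<close>, \<open>b\<close> of type HS, \<open>b\<close> is the end of the \<^term>\<open>S\<close>-step.\<close>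

definition join_SS :: "'a rel \<Rightarrow> 'a rel \<Rightarrow> 'a \<Rightarrow> 'a \<Rightarrow> bool" where
  "join_SS T H a b \<longleftrightarrow> (\<exists>d e. (a, d) \<in> T\<^sup>* \<and> (d, e) \<in> H\<^sup>= \<and> (b, e) \<in> T\<^sup>*)"

definition join_HS :: "'a rel \<Rightarrow> 'a rel \<Rightarrow> 'a rel \<Rightarrow> 'a \<Rightarrow> 'a \<Rightarrow> bool" where
  "join_HS S T H a b \<longleftrightarrow> (\<exists>e. (a, e) \<in> H\<^sup>= \<and> (b, e) \<in> T\<^sup>*) \<or>
     (\<exists>a'. (a, a') \<in> S \<and> join_SS T H a' b)"

lemma join_SS_sym: "sym H \<Longrightarrow> join_SS T H a b \<Longrightarrow> join_SS T H b a"
  unfolding join_SS_def sym_def by blast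

lemma rtrancl_image:
  assumes "\<And>x y. (x, y) \<in> R \<Longrightarrow> (f x, f y) \<in> R"
  shows "(x, y) \<in> R\<^sup>* \<Longrightarrow> (f x, f y) \<in> R\<^sup>*"
  by (induction rule: rtrancl_induct) (auto intro: assms rtrancl_into_rtrancl)

lemma join_SS_image:
  assumes "\<And>x y. (x, y) \<in> T \<Longrightarrow> (f x, f y) \<in> T" "\<And>x y. (x, y) \<in> H \<Longrightarrow> (f x, f y) \<in> H"
    and "join_SS T H a b"
  shows "join_SS T H (f a) (f b)"
proof -
  obtain d e where "(a, d) \<in> T\<^sup>*" "(d, e) \<in> H\<^sup>=" "(b, e) \<in> T\<^sup>*"
    using assms(3) unfolding join_SS_def by blast
  then have "(f a, f d) \<in> T\<^sup>*" "(f d, f e) \<in> H\<^sup>=" "(f b, f e) \<in> T\<^sup>*"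
    using rtrancl_image[of T f, OF assms(1)] assms(2) by auto
  then show ?thesis unfolding join_SS_def by blast
qed

lemma join_HS_image:
  assumes "\<And>x y. (x, y) \<in> S \<Longrightarrow> (f x, f y) \<in> S" "\<And>x y. (x, y) \<in> T \<Longrightarrow> (f x, f y) \<in> T"
    and "\<And>x y. (x, y) \<in> H \<Longrightarrow> (f x, f y) \<in> H"
    and "join_HS S T H a b"
  shows "join_HS S T H (f a) (f b)"
  using assms(4) unfolding join_HS_def
proof (elim disjE exE conjE)
  fix e assume "(a, e) \<in> H\<^sup>=" "(b, e) \<in> T\<^sup>*"
  then have "(f a, f e) \<in> H\<^sup>=" "(f b, f e) \<in> T\<^sup>*"
    using rtrancl_image[of T f, OF assms(2)] assms(3) by auto
  then show "(\<exists>e. (f a, e) \<in> H\<^sup>= \<and> (f b, e) \<in> T\<^sup>*) \<or> (\<exists>a'. (f a, a') \<in> S \<and> join_SS T H a' (f b))"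
    by blast
next
  fix a' assume a': "(a, a') \<in> S" "join_SS T H a' b"
  have "join_SS T H (f a') (f b)"
    using join_SS_image[of T f H, OF assms(2,3) a'(2)] .
  then show "(\<exists>e. (f a, e) \<in> H\<^sup>= \<and> (f b, e) \<in> T\<^sup>*) \<or> (\<exists>a'. (f a, a') \<in> S \<and> join_SS T H a' (f b))"
    using assms(1)[OF a'(1)] by blast
qed

lemma rstep_arg_update:
  assumes "i < length ts" "wf_trm F (Fun f ts)" "(x, y) \<in> rstep F R"
  shows "(Fun f (ts[i := x]), Fun f (ts[i := y])) \<in> rstep F R"
  using rstep_arg[of "ts[i := x]" i y F R f] assms wf_trm_update[OF assms(2) rstep_wf_left[OF assms(3)]]
  by simp

lemma join_SS_subset:
  assumes "r \<subseteq> T\<^sup>* O (H\<inverse>)\<^sup>= O (T\<inverse>)\<^sup>*" "sym H" "(a, b) \<in> r"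
  shows "join_SS T H a b"
proof -
  obtain d e where "(a, d) \<in> T\<^sup>*" "(d, e) \<in> (H\<inverse>)\<^sup>=" "(e, b) \<in> (T\<inverse>)\<^sup>*"
    using subsetD[OF assms(1,3)] by (elim relcompEpair) (rule that)
  then show ?thesis unfolding join_SS_def rtrancl_converse using assms(2) by (auto simp: sym_conv_converse_eq)
qed

lemma join_HS_subset:
  assumes "r \<subseteq> ((H\<inverse>)\<^sup>= O (T\<inverse>)\<^sup>*) \<union> (S O T\<^sup>* O (H\<inverse>)\<^sup>= O (T\<inverse>)\<^sup>*)" "sym H" "(a, b) \<in> r"
  shows "join_HS S T H a b"
proof -
  have H: "H\<inverse> = H" using assms(2) by (simp add: sym_conv_converse_eq)
  consider e where "(a, e) \<in> H\<^sup>=" "(e, b) \<in> (T\<inverse>)\<^sup>*"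
    | a' where "(a, a') \<in> S" "(a', b) \<in> T\<^sup>* O (H\<inverse>)\<^sup>= O (T\<inverse>)\<^sup>*"
    using subsetD[OF assms(1,3)] unfolding H by (elim UnE relcompEpair[of a b]) (blast+)
  then show ?thesis
  proof cases
    case 1
    then show ?thesis unfolding join_HS_def rtrancl_converse by blast
  next
    case 2
    then show ?thesis using join_SS_subset[OF subset_refl assms(2)] unfolding join_HS_def by blast
  qed
qed

lemma join_HS_subset':
  assumes "r \<subseteq> (T\<^sup>* O H\<^sup>=) \<union> (T\<^sup>* O H\<^sup>= O (T\<inverse>)\<^sup>* O S\<inverse>)" "sym H" "(b, a) \<in> r"
  shows "join_HS S T H a b"
proof -
  consider e where "(b, e) \<in> T\<^sup>*" "(e, a) \<in> H\<^sup>="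
    | d e a' where "(b, d) \<in> T\<^sup>*" "(d, e) \<in> H\<^sup>=" "(e, a') \<in> (T\<inverse>)\<^sup>*" "(a', a) \<in> S\<inverse>"
    using subsetD[OF assms(1,3)] by (elim UnE relcompEpair) (blast+)
  then show ?thesis
  proof cases
    case 1
    then show ?thesis using assms(2) unfolding join_HS_def sym_def by blast
  next
    case 2
    then show ?thesis using assms(2) unfolding join_HS_def join_SS_def sym_def rtrancl_converse by blast
  qed
qed

lemma local_peak_SS:
  fixes S H I :: "('f, 'v) rule set"
  assumes inf: "infinite (UNIV :: 'v set)" and S: "trs F S" "linear_trs S"
    and H: "sym (rstep F H)"
    and CP: "CP F S S \<subseteq>
      (rstep F (S \<union> I))\<^sup>* O ((rstep F H)\<inverse>)\<^sup>= O ((rstep F (S \<union> I))\<inverse>)\<^sup>*"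
    and peak: "(c, a) \<in> rstep F S" "(c, b) \<in> rstep F S"
  shows "join_SS (rstep F (S \<union> I)) (rstep F H) a b"
proof -
  let ?T = "rstep F (S \<union> I)" and ?H = "rstep F H"
  have wf: "wf_rules F S" and vars: "\<forall>(l, r)\<in>S. vars r \<subseteq> vars l"
    using S(1) by (auto simp: trs_def wf_rules_def)
  have ST: "rstep F S \<subseteq> ?T" by (rule rstep_mono) simp
  have root: "join_SS ?T ?H (r \<cdot> \<sigma>) b"
    if lr: "(l, r) \<in> S" "is_sbst F \<sigma>" "wf_trm F (l \<cdot> \<sigma>)" and b: "(l \<cdot> \<sigma>, b) \<in> rstep F S" for l r \<sigma> b
    using inf wf wf disjI1[OF vars] lr b
  proof (cases rule: root_peak_cases)
    case trivial
    then show ?thesis by (auto simp: join_SS_def)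
  next
    case (critical u v \<gamma>)
    have "join_SS ?T ?H (u \<cdot> \<gamma>) (v \<cdot> \<gamma>)"
      using join_SS_image[of ?T "\<lambda>t. t \<cdot> \<gamma>" ?H] rstep_sbst critical(2)
        join_SS_subset[OF CP H critical(1)] by metis
    then show ?thesis using join_SS_sym[OF H] critical by simp
  next
    case (variable p x u)
    have lin: "linear_trm l" "linear_trm r" using S(2) lr(1) by (auto simp: linear_trs_def)
    obtain \<tau> where "(l \<cdot> \<tau>, r \<cdot> \<tau>) \<in> rstep F S" "b = l \<cdot> \<tau>" "(r \<cdot> \<sigma>, r \<cdot> \<tau>) \<in> (rstep F S)\<^sup>="
      using variable_peak[OF wf wf lr variable(1-3)] lin variable(4) by metis
    then have "(b, r \<cdot> \<tau>) \<in> ?T\<^sup>*" "(r \<cdot> \<sigma>, r \<cdot> \<tau>) \<in> ?T\<^sup>*" using ST by auto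
    then show ?thesis unfolding join_SS_def by blast
  qed
  show ?thesis
  proof (rule peak_cases[OF peak])
    show "join_SS ?T ?H a (r \<cdot> \<sigma>)"
      if "(l, r) \<in> S" "is_sbst F \<sigma>" "wf_trm F (l \<cdot> \<sigma>)" "(l \<cdot> \<sigma>, a) \<in> rstep F S" for l r \<sigma> a
      using join_SS_sym[OF H root[OF that]] .
    show "join_SS ?T ?H a b" if "(a, d) \<in> rstep F S" "(b, d) \<in> rstep F S" for a b d
      using that ST unfolding join_SS_def by blast
    show "join_SS ?T ?H (Fun f (ts[i := a])) (Fun f (ts[i := b]))"
      if "i < length ts" "wf_trm F (Fun f ts)" "join_SS ?T ?H a b" for f ts i a b
      using join_SS_image[of ?T "\<lambda>t. Fun f (ts[i := t])" ?H] rstep_arg_update that by metis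
  qed (use root wf in auto)
qed

lemma local_peak_HS:
  fixes S H I :: "('f, 'v) rule set"
  assumes inf: "infinite (UNIV :: 'v set)" and S: "trs F S" "linear_trs S"
    and H: "sym (rstep F H)" "wf_rules F H"
    and CP_HS: "CP F H S \<subseteq>
      (((rstep F H)\<inverse>)\<^sup>= O ((rstep F (S \<union> I))\<inverse>)\<^sup>*) \<union>
      (rstep F S O (rstep F (S \<union> I))\<^sup>* O ((rstep F H)\<inverse>)\<^sup>= O ((rstep F (S \<union> I))\<inverse>)\<^sup>*)"
    and CP_SH: "CP F S H \<subseteq>
      ((rstep F (S \<union> I))\<^sup>* O (rstep F H)\<^sup>=) \<union>
      ((rstep F (S \<union> I))\<^sup>* O (rstep F H)\<^sup>= O ((rstep F (S \<union> I))\<inverse>)\<^sup>* O (rstep F S)\<inverse>)"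
    and peak: "(c, a) \<in> rstep F H" "(c, b) \<in> rstep F S"
  shows "join_HS (rstep F S) (rstep F (S \<union> I)) (rstep F H) a b"
proof -
  let ?T = "rstep F (S \<union> I)" and ?H = "rstep F H" and ?S = "rstep F S"
  let ?J = "join_HS ?S ?T ?H"
  have wf: "wf_rules F S" and vars: "\<forall>(l, r)\<in>S. vars r \<subseteq> vars l"
    using S(1) by (auto simp: trs_def wf_rules_def)
  have ST: "?S \<subseteq> ?T" by (rule rstep_mono) simp
  have sbst: "?J (u \<cdot> \<gamma>) (v \<cdot> \<gamma>)" if "?J u v" "is_sbst F \<gamma>" for u v \<gamma>
    using join_HS_image[of ?S "\<lambda>t. t \<cdot> \<gamma>" ?T ?H] rstep_sbst that by metis
  show ?thesis
  proof (rule peak_cases[OF peak])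
    fix l r \<sigma> b
    assume lr: "(l, r) \<in> H" "is_sbst F \<sigma>" "wf_trm F (l \<cdot> \<sigma>)" and b: "(l \<cdot> \<sigma>, b) \<in> ?S"
    from inf H(2) wf disjI2[OF vars] lr b show "?J (r \<cdot> \<sigma>) b"
    proof (cases rule: root_peak_cases)
      case trivial
      then show ?thesis by (auto simp: join_HS_def)
    next
      case (critical u v \<gamma>)
      then show ?thesis using sbst join_HS_subset'[OF CP_SH H(1) critical(1)] by simp
    next
      case (variable p x u)
      obtain \<tau> where \<tau>: "(b, l \<cdot> \<tau>) \<in> ?S\<^sup>*" "(l \<cdot> \<tau>, r \<cdot> \<tau>) \<in> ?H"
        "r \<cdot> \<sigma> = r \<cdot> \<tau> \<or> (r \<cdot> \<sigma>, r \<cdot> \<tau>) \<in> ?S O ?S\<^sup>*"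
        using variable_peak[OF H(2) wf lr variable(1-3)] variable(4) by metis
      have "(r \<cdot> \<tau>, l \<cdot> \<tau>) \<in> ?H" "(b, l \<cdot> \<tau>) \<in> ?T\<^sup>*"
        using H(1) \<tau>(1,2) rtrancl_mono[OF ST] by (auto dest: symD)
      moreover have "(m, r \<cdot> \<tau>) \<in> ?T\<^sup>*" if "(m, r \<cdot> \<tau>) \<in> ?S\<^sup>*" for m
        using that rtrancl_mono[OF ST] by blast
      ultimately show ?thesis using \<tau>(3) unfolding join_HS_def join_SS_def by auto blast+
    qed
  next
    fix l r \<sigma> a
    assume lr: "(l, r) \<in> S" "is_sbst F \<sigma>" "wf_trm F (l \<cdot> \<sigma>)" and a: "(l \<cdot> \<sigma>, a) \<in> ?H"
    from inf wf H(2) disjI1[OF vars] lr a show "?J a (r \<cdot> \<sigma>)"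
    proof (cases rule: root_peak_cases)
      case trivial
      then show ?thesis by (auto simp: join_HS_def)
    next
      case (critical u v \<gamma>)
      then show ?thesis using sbst join_HS_subset[OF CP_HS H(1) critical(1)] by simp
    next
      case (variable p x u)
      have lin: "linear_trm l" "linear_trm r" using S(2) lr(1) by (auto simp: linear_trs_def)
      obtain \<tau> where "(l \<cdot> \<tau>, r \<cdot> \<tau>) \<in> ?S" "a = l \<cdot> \<tau>" "(r \<cdot> \<sigma>, r \<cdot> \<tau>) \<in> ?H\<^sup>="
        using variable_peak[OF wf H(2) lr variable(1-3)] lin variable(4) by metis
      then have "(a, r \<cdot> \<tau>) \<in> ?S" "(r \<cdot> \<tau>, r \<cdot> \<sigma>) \<in> ?H\<^sup>=" using H(1) by (auto dest: symD)
      then show ?thesis unfolding join_HS_def join_SS_def by blast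
    qed
  next
    fix a b d assume "(a, d) \<in> ?S" "(b, d) \<in> ?H"
    then show "?J a b" using H(1) unfolding join_HS_def join_SS_def sym_def by blast
  next
    fix f and ts :: "('f, 'v) trm list" and i a b
    assume "i < length ts" "wf_trm F (Fun f ts)" "?J a b"
    then show "?J (Fun f (ts[i := a])) (Fun f (ts[i := b]))"
      using join_HS_image[of ?S "\<lambda>t. Fun f (ts[i := t])" ?T ?H] rstep_arg_update by metis
  qed (fact H(2) wf)+
qed

theorem theorem3p8:
  fixes F :: "'f \<rightharpoonup> nat"
    and P S P' :: "('f, 'v) rule set"
  assumes "infinite (UNIV :: 'v set)"
    and "trs F P" and "trs F S" and "trs F P'"
    and "linear_trs S"
    and "reversible F P"
    and "P' \<subseteq> P \<union> P\<inverse>"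
    and "rel_terminating F S P'"
    and "CP F S S \<subseteq>
      (rstep F (S \<union> P'))\<^sup>* O ((rstep F (P \<union> P\<inverse>))\<inverse>)\<^sup>= O ((rstep F (S \<union> P'))\<inverse>)\<^sup>*"
    and "CP F (P \<union> P\<inverse>) S \<subseteq>
      (((rstep F (P \<union> P\<inverse>))\<inverse>)\<^sup>= O ((rstep F (S \<union> P'))\<inverse>)\<^sup>*) \<union>
      (rstep F S O (rstep F (S \<union> P'))\<^sup>* O ((rstep F (P \<union> P\<inverse>))\<inverse>)\<^sup>= O
        ((rstep F (S \<union> P'))\<inverse>)\<^sup>*)"
    and "CP F S (P \<union> P\<inverse>) \<subseteq>
      ((rstep F (S \<union> P'))\<^sup>* O (rstep F (P \<union> P\<inverse>))\<^sup>=) \<union>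
      ((rstep F (S \<union> P'))\<^sup>* O (rstep F (P \<union> P\<inverse>))\<^sup>= O
        ((rstep F (S \<union> P'))\<inverse>)\<^sup>* O (rstep F S)\<inverse>)"
  shows "confluent F (S \<union> P)"
proof -
  let ?H = "rstep F (P \<union> P\<inverse>)" and ?S = "rstep F S" and ?I = "rstep F P'"
  have wf: "wf_rules F (P \<union> P\<inverse>)" "wf_rules F P" "wf_rules F (P\<inverse>)"
    using assms(2) by (auto simp: trs_def wf_rules_def)
  have "(P \<union> P\<inverse>)\<inverse> = P \<union> P\<inverse>" by auto
  then have sym: "sym ?H" using rstep_converse[OF wf(1)] by (intro symI) simp
  interpret peaks_modulo ?S ?H ?I
  proof
    show "sym ?H" by (fact sym)
    show "?I \<subseteq> ?H" using assms(7) by (rule rstep_mono)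
    show "wf ((?S O ?I\<^sup>*)\<inverse>)" using assms(8) by (simp add: rel_terminating_def)
  next
    fix c a b assume "(c, a) \<in> ?S" "(c, b) \<in> ?S"
    from local_peak_SS[OF assms(1,3,5) sym assms(9) this]
    show "\<exists>d e. (a, d) \<in> (?S \<union> ?I)\<^sup>* \<and> (d, e) \<in> ?H\<^sup>= \<and> (b, e) \<in> (?S \<union> ?I)\<^sup>*"
      by (simp only: join_SS_def rstep_Un[of F S])
  next
    fix a c b assume "(a, c) \<in> ?H" "(c, b) \<in> ?S"
    from local_peak_HS[OF assms(1,3,5) sym wf(1) assms(10,11) symD[OF sym this(1)] this(2)]
    show "(\<exists>e. (a, e) \<in> ?H\<^sup>= \<and> (b, e) \<in> (?S \<union> ?I)\<^sup>*) \<or>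
      (\<exists>a' d e. (a, a') \<in> ?S \<and> (a', d) \<in> (?S \<union> ?I)\<^sup>* \<and> (d, e) \<in> ?H\<^sup>= \<and> (b, e) \<in> (?S \<union> ?I)\<^sup>*)"
      unfolding join_HS_def join_SS_def rstep_Un[of F S] by blast
  qed
  have "rstep F (P\<inverse>) \<subseteq> (rstep F P)\<^sup>*"
    using rstep_converse[OF wf(3)] assms(6) by (auto simp: reversible_def)
  then have "?H \<subseteq> (rstep F (S \<union> P))\<^sup>*"
    unfolding rstep_Un using rtrancl_mono[of "rstep F P" "?S \<union> rstep F P"] by auto
  then have "?S \<union> ?H \<subseteq> (rstep F (S \<union> P))\<^sup>*" by (auto simp: rstep_Un)
  moreover have "rstep F (S \<union> P) \<subseteq> ?S \<union> ?H" by (auto simp: rstep_Un)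
  ultimately have "(?S \<union> ?H)\<^sup>* = (rstep F (S \<union> P))\<^sup>*" by (simp add: rtrancl_subset)
  then show ?thesis
    using peak_imp_valley unfolding confluent_def
    by (intro confluentpI) (simp add: Enum.rtranclp_rtrancl_eq)
qed

end
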